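(* Let $$d=\operatorname{arccosh}\left(\frac{9+5\sqrt{5}+(4+\sqrt{5})\sqrt{22-2\sqrt{5}}}{22}\right)\approx 1.37503.$$ Then every $4$-coloring of the hyperbolic plane $\mathbb{H}^2$ (that is, every function $\kappa:\mathbb{H}^2\to\{1,2,3,4\}$) contains two identically colored points at hyperbolic distance exactly $d$ apart: there exist $P,Q\in\mathbb{H}^2$ with $d_{\mathbb{H}}(P,Q)=d$ and $\kappa(P)=\kappa(Q)$.
   Context: The hyperbolic plane is taken in the Poincaré disk model $\mathbb{H}^2=\{(x,y)\in\mathbb{R}^2 : x^2+y^2<1\}$ with hyperbolic distance $$d_{\mathbb{H}}((x_1,y_1),(x_2,y_2))=\operatorname{arccosh}\left(1+2\cdot\frac{(x_1-x_2)^2+(y_1-y_2)^2}{(1-x_1^2-y_1^2)(1-x_2^2-y_2^2)}\right).$$ Colorings are arbitrary functions (no measurability or other regularity is assumed). *)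

theory Defs
  imports "HOL-Analysis.Analysis"
begin

definition hyp_plane :: "(real \<times> real) set" where
  "hyp_plane = {(x, y). x\<^sup>2 + y\<^sup>2 < 1}"

(* Only meaningful for points of hyp_plane, where the argument of arcosh is at least 1. *)
fun hyp_dist :: "real \<times> real \<Rightarrow> real \<times> real \<Rightarrow> real" where
  "hyp_dist (x1, y1) (x2, y2) =
     arcosh (1 + 2 * (((x1 - x2)\<^sup>2 + (y1 - y2)\<^sup>2) /
                      ((1 - x1\<^sup>2 - y1\<^sup>2) * (1 - x2\<^sup>2 - y2\<^sup>2))))"

end

theory Submission
  imports Defs
begin

text \<open>
  Let \<open>C = cosh d\<close> and let \<open>\<alpha>\<close> be the angle of the equilateral triangle of side \<open>d\<close>, so that
  \<open>cos \<alpha> = C / (1 + C)\<close>. Put \<open>u = 2 cos \<alpha>\<close>. The value of \<open>d\<close> is the one for which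
  \<open>u - 1 / u = 2 cos 72\<degree>\<close>; geometrically, seven equilateral triangles and one tip of a regular
  pentagram of side \<open>d\<close> then fit exactly around a point. Because of this relation the unit-distance
  graph obtained by gluing equilateral triangles edge to edge has many more edges than the triangles
  account for, and the proof exploits these coincidences.

  Suppose that a 4-colouring had no two points of the same colour at distance \<open>d\<close>. Call an edge of
  the graph \<open>Eq\<close> if the two triangles on it have apexes of the same colour, and \<open>Ne\<close> otherwise.
  The successive neighbours \<open>n\<^sub>0, n\<^sub>1, \<dots>\<close> of a point \<open>P\<close>, each obtained from the previous one by
  a rotation through \<open>\<alpha>\<close>, use only three colours, so up to a permutation the labels of the edges
  \<open>P n\<^sub>1, P n\<^sub>2, \<dots>\<close> determine the colours of all \<open>n\<^sub>i\<close>. Since the hyperbolic plane is homogeneous, a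
  word of labels that is impossible around one point is impossible around every point, and each word
  excluded in this way becomes a new constraint on all points of a larger configuration.

  The start is a small gadget (lemma \<open>valid_gadget\<close>): the second common neighbours of
  \<open>n\<^sub>0, n\<^sub>5\<close>, of \<open>n\<^sub>2, n\<^sub>5\<close> and of \<open>n\<^sub>2, n\<^sub>7\<close> form an equilateral triangle of side \<open>d\<close>. If
  \<open>n\<^sub>0 = n\<^sub>2 \<noteq> n\<^sub>5 = n\<^sub>7\<close> as colours, all three of its vertices must avoid the same two
  colours, which is absurd. From the gadget one excludes in turn longer words with two adjacent \<open>Eq\<close>,
  then \<open>Eq Eq\<close>, then \<open>Eq\<close> itself, and finally \<open>Ne\<close>. No label is left for any edge.

  Each exclusion is a finite case distinction on at most a hundred or so colour choices. It is recorded
  as a certificate: a list of points with coordinates in \<open>\<int>[u]\<close> with respect to a base triangle, the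
  edges in use, the instances of earlier exclusions in use, and a decision tree. Lemma
  \<open>certificate_sound\<close> says that a certificate accepted by the checker \<open>valid\<close> proves an
  exclusion. The points live on the hyperboloid, where distance \<open>d\<close> means that the Minkowski product is
  \<open>C\<close>, so that checking an edge is exact arithmetic in \<open>\<int>[u]\<close>.
\<close>

section \<open>The hyperboloid model\<close>

fun mink :: "real \<times> real \<times> real \<Rightarrow> real \<times> real \<times> real \<Rightarrow> real" where
  "mink (t, x, y) (t', x', y') = t * t' - x * x' - y * y'"

lemma mink_commute: "mink v w = mink w v"
  by (cases v; cases w) (simp add: algebra_simps)

lemma mink_add_left: "mink (v + w) z = mink v z + mink w z"
  by (cases v; cases w; cases z) (simp add: algebra_simps)

lemma mink_scaleR_left: "mink (c *\<^sub>R v) w = c * mink v w"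
  by (cases v; cases w) (simp add: algebra_simps)

lemma mink_add_right: "mink z (v + w) = mink z v + mink z w"
  by (metis mink_commute mink_add_left)

lemma mink_scaleR_right: "mink w (c *\<^sub>R v) = c * mink w v"
  by (metis mink_commute mink_scaleR_left)

lemmas mink_bilinear = mink_add_left mink_scaleR_left mink_add_right mink_scaleR_right

text \<open>
  The projection to the Poincare disk, with both sheets of the hyperboloid \<open>mink v v = 1\<close> folded
  onto the same disk. A colouring of the disk thus pulls back to the whole hyperboloid, and the
  combinatorial part never has to ask on which sheet a point lies.
\<close>

fun disc_point :: "real \<times> real \<times> real \<Rightarrow> real \<times> real" where
  "disc_point (t, x, y) = (x / (t + sgn t), y / (t + sgn t))"

lemma disc_point_uminus: "disc_point (- v) = disc_point v"
proof (cases v)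
  case (fields t x y)
  have "- t + sgn (- t) = - (t + sgn t)"
    by (simp add: sgn_minus)
  then show ?thesis
    by (simp only: fields disc_point.simps uminus_Pair minus_divide_divide)
qed

lemma unit_time_coordinate:
  assumes "mink (t, x, y) (t, x, y) = 1"
  shows "t\<^sup>2 = 1 + x\<^sup>2 + y\<^sup>2" and "1 \<le> \<bar>t\<bar>"
proof -
  show "t\<^sup>2 = 1 + x\<^sup>2 + y\<^sup>2"
    using assms by (simp add: power2_eq_square)
  then have "1\<^sup>2 \<le> t\<^sup>2" by simp
  then show "1 \<le> \<bar>t\<bar>" by (metis abs_le_square_iff abs_one)
qed

lemma one_minus_disc_point:
  fixes t x y :: real
  assumes "t\<^sup>2 = 1 + x\<^sup>2 + y\<^sup>2" and "1 \<le> t"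
  shows "1 - (x / (t + 1))\<^sup>2 - (y / (t + 1))\<^sup>2 = 2 / (t + 1)"
proof -
  have "(1 - (x / (t + 1))\<^sup>2 - (y / (t + 1))\<^sup>2) * (t + 1)\<^sup>2 = (t + 1)\<^sup>2 - x\<^sup>2 - y\<^sup>2"
    using assms(2) by (simp add: power_divide field_simps)
  also have "\<dots> = 2 / (t + 1) * (t + 1)\<^sup>2"
    using assms by (simp add: field_simps power2_eq_square)
  finally show ?thesis
  proof -
    assume "(1 - (x / (t + 1))\<^sup>2 - (y / (t + 1))\<^sup>2) * (t + 1)\<^sup>2 = 2 / (t + 1) * (t + 1)\<^sup>2"
    moreover have "(t + 1)\<^sup>2 \<noteq> 0" using assms(2) by simp
    ultimately show ?thesis using mult_right_cancel by blast
  qed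
qed

lemma disc_point_in_hyp_plane:
  assumes "mink v v = 1"
  shows "disc_point v \<in> hyp_plane"
proof -
  have pos: "disc_point (t, x, y) \<in> hyp_plane" if "mink (t, x, y) (t, x, y) = 1" "0 < t" for t x y
  proof -
    have t: "t\<^sup>2 = 1 + x\<^sup>2 + y\<^sup>2" "1 \<le> t"
      using unit_time_coordinate[OF that(1)] that(2) by auto
    have "0 < 2 / (t + 1)"
      using t(2) by simp
    then have "(x / (t + 1))\<^sup>2 + (y / (t + 1))\<^sup>2 < 1"
      using one_minus_disc_point[OF t] by linarith
    then show ?thesis
      unfolding hyp_plane_def disc_point.simps sgn_pos[OF that(2)] by simp
  qed
  obtain t x y where v: "v = (t, x, y)" by (cases v)
  consider "0 < t" | "t < 0"
    using unit_time_coordinate(2)[of t x y] assms v by force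
  then show ?thesis
  proof cases
    case 1
    then show ?thesis using pos assms v by blast
  next
    case 2
    have "disc_point (- t, - x, - y) \<in> hyp_plane"
      using 2 assms v by (intro pos) simp_all
    then show ?thesis
      unfolding uminus_Pair[symmetric] disc_point_uminus v .
  qed
qed

lemma hyp_dist_disc_point_upper:
  assumes v: "mink (t, x, y) (t, x, y) = 1" "0 < t"
    and w: "mink (t', x', y') (t', x', y') = 1" "0 < t'"
  shows "hyp_dist (disc_point (t, x, y)) (disc_point (t', x', y')) =
    arcosh (mink (t, x, y) (t', x', y'))"
proof -
  have t: "t\<^sup>2 = 1 + x\<^sup>2 + y\<^sup>2" "1 \<le> t"
    using unit_time_coordinate[OF v(1)] v(2) by auto
  have t': "t'\<^sup>2 = 1 + x'\<^sup>2 + y'\<^sup>2" "1 \<le> t'"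
    using unit_time_coordinate[OF w(1)] w(2) by auto
  define D where "D = (x / (t + 1) - x' / (t' + 1))\<^sup>2 + (y / (t + 1) - y' / (t' + 1))\<^sup>2"
  have "D * ((t + 1) * (t' + 1))\<^sup>2 =
      (x * (t' + 1) - x' * (t + 1))\<^sup>2 + (y * (t' + 1) - y' * (t + 1))\<^sup>2"
  proof -
    have "(x / (t + 1) - x' / (t' + 1)) * ((t + 1) * (t' + 1)) = x * (t' + 1) - x' * (t + 1)"
      and "(y / (t + 1) - y' / (t' + 1)) * ((t + 1) * (t' + 1)) = y * (t' + 1) - y' * (t + 1)"
      using t(2) t'(2) by (simp_all add: left_diff_distrib)
    then show ?thesis
      unfolding D_def distrib_right power_mult_distrib[symmetric] by simp
  qed
  also have "\<dots> = (x\<^sup>2 + y\<^sup>2) * (t' + 1)\<^sup>2 + (x'\<^sup>2 + y'\<^sup>2) * (t + 1)\<^sup>2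
      - 2 * (x * x' + y * y') * ((t + 1) * (t' + 1))"
    by (simp add: power2_eq_square algebra_simps)
  also have "\<dots> = (t\<^sup>2 - 1) * (t' + 1)\<^sup>2 + (t'\<^sup>2 - 1) * (t + 1)\<^sup>2
      - 2 * (x * x' + y * y') * ((t + 1) * (t' + 1))"
    using t(1) t'(1) by simp
  also have "\<dots> = 2 * (mink (t, x, y) (t', x', y') - 1) * ((t + 1) * (t' + 1))"
    by (simp add: power2_eq_square algebra_simps)
  finally have "D * ((t + 1) * (t' + 1)) * ((t + 1) * (t' + 1)) =
      2 * (mink (t, x, y) (t', x', y') - 1) * ((t + 1) * (t' + 1))"
    by (simp add: power2_eq_square algebra_simps)
  then have D: "D * ((t + 1) * (t' + 1)) = 2 * (mink (t, x, y) (t', x', y') - 1)"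
    using t(2) t'(2) by simp
  have "1 + 2 * (D / (2 / (t + 1) * (2 / (t' + 1)))) = 1 + D * ((t + 1) * (t' + 1)) / 2"
    using t(2) t'(2) by (simp add: field_simps)
  also have "\<dots> = mink (t, x, y) (t', x', y')"
    unfolding D by (simp add: field_simps)
  finally show ?thesis
    using v(2) w(2) unfolding disc_point.simps hyp_dist.simps sgn_pos[OF v(2)] sgn_pos[OF w(2)]
      one_minus_disc_point[OF t] one_minus_disc_point[OF t'] D_def by simp
qed

text \<open>
  By Cauchy--Schwarz the space part of the product of two unit vectors is smaller in absolute value
  than its time part, which therefore has the sign of the whole product.
\<close>

lemma same_sheet:
  assumes v: "mink (t, x, y) (t, x, y) = 1" and w: "mink (t', x', y') (t', x', y') = 1"
    and pos: "0 < mink (t, x, y) (t', x', y')"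
  shows "0 < t * t'"
proof -
  have "(x * x' + y * y')\<^sup>2 \<le> (x\<^sup>2 + y\<^sup>2) * (x'\<^sup>2 + y'\<^sup>2)"
    using zero_le_power2[of "x * y' - y * x'"] by (simp add: power2_eq_square algebra_simps)
  also have "\<dots> = (t\<^sup>2 - 1) * (t'\<^sup>2 - 1)"
    using unit_time_coordinate(1)[OF v] unit_time_coordinate(1)[OF w] by simp
  also have "\<dots> < (t * t')\<^sup>2"
  proof -
    have "1 \<le> t\<^sup>2" "1 \<le> t'\<^sup>2"
      using unit_time_coordinate(1)[OF v] unit_time_coordinate(1)[OF w] by simp_all
    then show ?thesis by (simp add: power_mult_distrib algebra_simps)
  qed
  finally have "\<bar>x * x' + y * y'\<bar> < \<bar>t * t'\<bar>"
    using abs_le_square_iff linorder_not_le by blast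
  then show ?thesis
    using pos by (simp add: abs_if split: if_splits)
qed

lemma hyp_dist_disc_point:
  assumes "mink v v = 1" and "mink w w = 1" and "0 < mink v w"
  shows "hyp_dist (disc_point v) (disc_point w) = arcosh (mink v w)"
proof -
  obtain t x y where v: "v = (t, x, y)" by (cases v)
  obtain t' x' y' where w: "w = (t', x', y')" by (cases w)
  consider "0 < t" "0 < t'" | "t < 0" "t' < 0"
    using same_sheet assms v w by (metis zero_less_mult_iff)
  then show ?thesis
  proof cases
    case 1
    then show ?thesis using assms v w hyp_dist_disc_point_upper by blast
  next
    case 2
    have "hyp_dist (disc_point (- t, - x, - y)) (disc_point (- t', - x', - y')) =
        arcosh (mink (- t, - x, - y) (- t', - x', - y'))"
      using 2 assms v w by (intro hyp_dist_disc_point_upper) simp_all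
    then show ?thesis
      unfolding uminus_Pair[symmetric] disc_point_uminus v w
      by (simp only: uminus_Pair mink.simps) simp
  qed
qed

section \<open>Exact arithmetic in \<open>\<int>[u]\<close>\<close>

text \<open>A quadruple stands for \<open>a0 + a1 u + a2 u\<^sup>2 + a3 u\<^sup>3\<close>, and a triple of quadruples for the
  coordinates of a vector with respect to the vertices of an equilateral triangle.\<close>

type_synonym zu = "int \<times> int \<times> int \<times> int"
type_synonym zvec = "zu \<times> zu \<times> zu"

fun zadd :: "zu \<Rightarrow> zu \<Rightarrow> zu" where
  "zadd (a0, a1, a2, a3) (b0, b1, b2, b3) = (a0 + b0, a1 + b1, a2 + b2, a3 + b3)"

fun zsub :: "zu \<Rightarrow> zu \<Rightarrow> zu" where
  "zsub (a0, a1, a2, a3) (b0, b1, b2, b3) = (a0 - b0, a1 - b1, a2 - b2, a3 - b3)"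

fun zscale :: "int \<Rightarrow> zu \<Rightarrow> zu" where
  "zscale k (b0, b1, b2, b3) = (k * b0, k * b1, k * b2, k * b3)"

text \<open>Here the relation \<open>u\<^sup>4 = - u\<^sup>3 + 3 u\<^sup>2 + u - 1\<close> enters.\<close>

fun ztimes_u :: "zu \<Rightarrow> zu" where
  "ztimes_u (a0, a1, a2, a3) = (- a3, a0 + a3, a1 + 3 * a3, a2 - a3)"

fun zmult :: "zu \<Rightarrow> zu \<Rightarrow> zu" where
  "zmult (a0, a1, a2, a3) b =
     zadd (zscale a0 b) (ztimes_u (zadd (zscale a1 b) (ztimes_u
       (zadd (zscale a2 b) (ztimes_u (zscale a3 b))))))"

text \<open>
  The reflection of \<open>r\<close> in the edge \<open>p q\<close> of an equilateral triangle \<open>p q r\<close> is \<open>u (p + q) - r\<close>.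
  Starting from the base triangle, flips therefore never leave the lattice with coordinates in \<open>\<int>[u]\<close>.
\<close>

fun zflip :: "zvec \<Rightarrow> zvec \<Rightarrow> zvec \<Rightarrow> zvec" where
  "zflip (p0, p1, p2) (q0, q1, q2) (r0, r1, r2) =
     (zsub (ztimes_u (zadd p0 q0)) r0, zsub (ztimes_u (zadd p1 q1)) r1,
      zsub (ztimes_u (zadd p2 q2)) r2)"

fun zsum :: "zvec \<Rightarrow> zu" where
  "zsum (p0, p1, p2) = zadd p0 (zadd p1 p2)"

fun zdot :: "zvec \<Rightarrow> zvec \<Rightarrow> zu" where
  "zdot (p0, p1, p2) (q0, q1, q2) = zadd (zmult p0 q0) (zadd (zmult p1 q1) (zmult p2 q2))"

text \<open>
  For unit vectors with pairwise product \<open>C\<close>, the product of two combinations is \<open>S + C (T - S)\<close>, where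
  \<open>S\<close> is the dot product of the coordinates and \<open>T\<close> the product of the coordinate sums. As
  \<open>C = u / (2 - u)\<close>, the multiple by \<open>2 - u\<close> lies in \<open>\<int>[u]\<close>: it is \<open>(2 - 2 u) S + u T\<close>.
\<close>

definition zform :: "zvec \<Rightarrow> zvec \<Rightarrow> zu" where
  "zform p q = zadd (zmult (2, - 2, 0, 0) (zdot p q)) (ztimes_u (zmult (zsum p) (zsum q)))"

definition zunit :: "zvec \<Rightarrow> bool" where
  "zunit p \<longleftrightarrow> zform p p = (2, - 1, 0, 0)"

definition zadjacent :: "zvec \<Rightarrow> zvec \<Rightarrow> bool" where
  "zadjacent p q \<longleftrightarrow> zform p q = (0, 1, 0, 0)"

fun zval :: "real \<Rightarrow> zu \<Rightarrow> real" where
  "zval u (a0, a1, a2, a3) = a0 + a1 * u + a2 * u ^ 2 + a3 * u ^ 3"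

lemma zval_zadd: "zval u (zadd a b) = zval u a + zval u b"
  by (cases a; cases b) (simp add: algebra_simps)

lemma zval_zsub: "zval u (zsub a b) = zval u a - zval u b"
  by (cases a; cases b) (simp add: algebra_simps)

lemma zval_zscale: "zval u (zscale k b) = k * zval u b"
  by (cases b) (simp add: algebra_simps)

fun combine :: "real \<Rightarrow> 'a::real_vector \<Rightarrow> 'a \<Rightarrow> 'a \<Rightarrow> zvec \<Rightarrow> 'a" where
  "combine u P Q R (p0, p1, p2) = zval u p0 *\<^sub>R P + zval u p1 *\<^sub>R Q + zval u p2 *\<^sub>R R"

section \<open>Patterns and certificates\<close>

text \<open>
  A triple \<open>(i, j, b)\<close> demands that the points with numbers \<open>i\<close> and \<open>j\<close> have equal (\<open>b\<close>) or different
  (\<open>\<not> b\<close>) colours. Patterns speak only of equality of colours, so they do not change when the four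
  colours are permuted.
\<close>

type_synonym pattern = "(nat \<times> nat \<times> bool) list"

text \<open>
  The two triangles on the edge from the centre of a fan to the outer point \<open>k + 1\<close> have the outer points
  \<open>k\<close> and \<open>k + 2\<close> as apexes. A word of labels therefore starts at the edge to the outer point 1, where
  outer points are counted from 0.
\<close>

datatype label = Eq | Ne

fun labels_from :: "nat \<Rightarrow> label list \<Rightarrow> pattern" where
  "labels_from k [] = []"
| "labels_from k (l # ls) = (k, k + 2, l = Eq) # labels_from (Suc k) ls"

abbreviation labels :: "label list \<Rightarrow> pattern" where
  "labels \<equiv> labels_from 0"

definition satisfies :: "(nat \<Rightarrow> 'a) \<Rightarrow> pattern \<Rightarrow> bool" where
  "satisfies g W \<longleftrightarrow> (\<forall>(i, j, b) \<in> set W. (g i = g j) = b)"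

lemma satisfies_Nil [simp]: "satisfies g []"
  by (simp add: satisfies_def)

lemma satisfies_Cons [simp]:
  "satisfies g ((i, j, b) # W) \<longleftrightarrow> (g i = g j) = b \<and> satisfies g W"
  by (simp add: satisfies_def)

text \<open>
  A decision tree: \<open>Split v\<close> tries the colours 0 to 3 for \<open>v\<close>, \<open>Edge w\<close> closes a branch because \<open>w\<close> is a
  neighbour of the vertex coloured last and has the same colour, and \<open>Clash k\<close> closes it because the
  \<open>k\<close>-th forbidden pattern is realised.
\<close>

datatype refutation =
    Split nat refutation refutation refutation refutation
  | Edge nat
  | Clash nat

fun clashes :: "nat list list \<Rightarrow> (nat \<times> nat) list \<Rightarrow> nat \<Rightarrow> bool" where
  "clashes adj [] w = False"
| "clashes adj ((v, c) # s) w =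
     (v < length adj \<and> w \<in> set (adj ! v) \<and> map_of s w = Some c)"

fun agree :: "nat option \<Rightarrow> nat option \<Rightarrow> bool \<Rightarrow> bool" where
  "agree (Some c) (Some c') b = ((c = c') = b)"
| "agree x y b = False"

fun realised :: "(nat \<times> nat) list \<Rightarrow> pattern \<Rightarrow> bool" where
  "realised s [] = True"
| "realised s ((i, j, b) # W) = (agree (map_of s i) (map_of s j) b \<and> realised s W)"

fun refutes :: "nat list list \<Rightarrow> pattern list \<Rightarrow> (nat \<times> nat) list \<Rightarrow> refutation \<Rightarrow> bool" where
  "refutes adj Ws s (Split v t0 t1 t2 t3) =
     (refutes adj Ws ((v, 0) # s) t0 \<and> refutes adj Ws ((v, 1) # s) t1 \<and>
      refutes adj Ws ((v, 2) # s) t2 \<and> refutes adj Ws ((v, 3) # s) t3)"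
| "refutes adj Ws s (Edge w) = clashes adj s w"
| "refutes adj Ws s (Clash k) = (k < length Ws \<and> realised s (Ws ! k))"

lemma realised_sound:
  assumes "realised s W" and "\<forall>v c. (v, c) \<in> set s \<longrightarrow> g v = c"
  shows "satisfies g W"
  using assms
proof (induction s W rule: realised.induct)
  case (2 s i j b W)
  then obtain c c' where c: "map_of s i = Some c" "map_of s j = Some c'" "(c = c') = b"
    by (cases "map_of s i"; cases "map_of s j") auto
  then have "(i, c) \<in> set s" "(j, c') \<in> set s"
    by (simp_all add: map_of_SomeD)
  then have "g i = c" "g j = c'"
    using 2(3) by blast+
  then show ?case
    using c 2 by simp
qed simp

lemma refutes_sound:
  assumes "refutes adj Ws s t"
    and edge: "\<And>v w. v < length adj \<Longrightarrow> w \<in> set (adj ! v) \<Longrightarrow> g v \<noteq> g w"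
    and avoid: "\<And>W. W \<in> set Ws \<Longrightarrow> \<not> satisfies g W"
    and range: "\<And>v. g v < (4 :: nat)"
    and "\<forall>v c. (v, c) \<in> set s \<longrightarrow> g v = c"
  shows False
  using assms(1,5)
proof (induction t arbitrary: s)
  case (Split v t0 t1 t2 t3)
  consider "g v = 0" | "g v = 1" | "g v = 2" | "g v = 3"
    using range[of v] by linarith
  then show ?case
  proof cases
    case 1
    then show ?thesis using Split.IH(1)[of "(v, 0) # s"] Split.prems by auto
  next
    case 2
    then show ?thesis using Split.IH(2)[of "(v, 1) # s"] Split.prems by auto
  next
    case 3
    then show ?thesis using Split.IH(3)[of "(v, 2) # s"] Split.prems by auto
  next
    case 4
    then show ?thesis using Split.IH(4)[of "(v, 3) # s"] Split.prems by auto
  qed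
next
  case (Edge w)
  then obtain v c s' where s: "s = (v, c) # s'"
    by (cases s) auto
  then have "g w = c" "g v = c"
    using Edge by (auto dest!: map_of_SomeD)
  then show ?case
    using edge[of v w] Edge s by auto
next
  case (Clash k)
  then have "satisfies g (Ws ! k)"
    using realised_sound[of s "Ws ! k" g] by simp
  moreover have "Ws ! k \<in> set Ws"
    using Clash(1) by simp
  ultimately show ?case
    using avoid by blast
qed

text \<open>
  The components are: the flips that produce the points 3, 4, \<dots> from the base triangle with
  vertices 0, 1, 2 (the entry \<open>(p, q, r)\<close> reflects \<open>r\<close> in the edge \<open>p q\<close>); for each point a list of
  neighbours; the outer points of the fan around point 0 to which the target pattern refers; the instances
  \<open>(k, p, ms)\<close> of earlier exclusions, meaning that the \<open>k\<close>-th known pattern is impossible on the fan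
  with centre \<open>p\<close> and outer points \<open>ms\<close>; and the decision tree. Reading a fan backwards gives a fan
  again, so the mirror images of a forbidden word need no separate treatment.
\<close>

datatype certificate =
  Certificate "(nat \<times> nat \<times> nat) list" "nat list list" "nat list"
    "(nat \<times> nat \<times> nat list) list" refutation

definition basis :: "zvec list" where
  "basis = [((1, 0, 0, 0), (0, 0, 0, 0), (0, 0, 0, 0)),
            ((0, 0, 0, 0), (1, 0, 0, 0), (0, 0, 0, 0)),
            ((0, 0, 0, 0), (0, 0, 0, 0), (1, 0, 0, 0))]"

fun develop :: "zvec list \<Rightarrow> (nat \<times> nat \<times> nat) list \<Rightarrow> zvec list" where
  "develop vs [] = vs"
| "develop vs ((p, q, r) # fs) = develop (vs @ [zflip (vs ! p) (vs ! q) (vs ! r)]) fs"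

text \<open>
  The checking functions below are first-order recursions, without abstractions over the list of points,
  because they are evaluated by rewriting.
\<close>

fun adjacent_to :: "zvec list \<Rightarrow> zvec \<Rightarrow> nat list \<Rightarrow> bool" where
  "adjacent_to vs v [] = True"
| "adjacent_to vs v (w # ws) = (w < length vs \<and> zadjacent v (vs ! w) \<and> adjacent_to vs v ws)"

fun fan_steps :: "zvec \<Rightarrow> zvec list \<Rightarrow> bool" where
  "fan_steps p (a # b # c # ms) = (c = zflip p b a \<and> fan_steps p (b # c # ms))"
| "fan_steps p ms = True"

fun is_fan :: "zvec \<Rightarrow> zvec list \<Rightarrow> bool" where
  "is_fan p (a # b # ms) =
     (zadjacent p a \<and> zadjacent p b \<and> zadjacent a b \<and> fan_steps p (a # b # ms))"
| "is_fan p ms = False"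

fun below :: "nat \<Rightarrow> nat list \<Rightarrow> bool" where
  "below n [] = True"
| "below n (k # ks) = (k < n \<and> below n ks)"

fun fits :: "nat \<Rightarrow> pattern \<Rightarrow> bool" where
  "fits n [] = True"
| "fits n ((i, j, b) # W) = (i < n \<and> j < n \<and> fits n W)"

fun fan_ok :: "zvec list \<Rightarrow> nat \<Rightarrow> nat list \<Rightarrow> pattern \<Rightarrow> bool" where
  "fan_ok vs p ms W \<longleftrightarrow>
     fits (length ms) W \<and> below (length vs) (p # ms) \<and> is_fan (vs ! p) (map ((!) vs) ms)"

fun fans_ok :: "pattern list \<Rightarrow> zvec list \<Rightarrow> (nat \<times> nat \<times> nat list) list \<Rightarrow> bool" where
  "fans_ok Ks vs [] = True"
| "fans_ok Ks vs ((k, p, ms) # fs) =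
     (k < length Ks \<and> fan_ok vs p ms (Ks ! k) \<and> fans_ok Ks vs fs)"

fun place :: "nat list \<Rightarrow> pattern \<Rightarrow> pattern" where
  "place ms [] = []"
| "place ms ((i, j, b) # W) = (ms ! i, ms ! j, b) # place ms W"

fun placements :: "pattern list \<Rightarrow> (nat \<times> nat \<times> nat list) list \<Rightarrow> pattern list" where
  "placements Ks [] = []"
| "placements Ks ((k, p, ms) # fs) = place ms (Ks ! k) # placements Ks fs"

text \<open>
  In the case distinction the target pattern is an assumption. It is expressed by forbidding the negation
  of each of its triples.
\<close>

fun denials :: "pattern \<Rightarrow> pattern list" where
  "denials [] = []"
| "denials ((i, j, b) # W) = [(i, j, \<not> b)] # denials W"

fun geometry_ok :: "pattern list \<Rightarrow> pattern \<Rightarrow> zvec list \<Rightarrow> nat list list \<Rightarrow> nat list \<Rightarrow>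
    (nat \<times> nat \<times> nat list) list \<Rightarrow> bool" where
  "geometry_ok Ks W vs adj ms fs \<longleftrightarrow>
     list_all zunit vs \<and> list_all2 (adjacent_to vs) vs adj \<and>
     take 2 ms = [1, 2] \<and> fan_ok vs 0 ms W \<and> fans_ok Ks vs fs"

text \<open>
  The colours are named so that the outer points 1 and 2 of the base triangle have colours 0 and 1 and the
  centre has colour 3; this is the initial assignment of the decision tree.
\<close>

fun valid :: "pattern list \<Rightarrow> pattern \<Rightarrow> certificate \<Rightarrow> bool" where
  "valid Ks W (Certificate flips adj ms fs t) \<longleftrightarrow>
     geometry_ok Ks W (develop basis flips) adj ms fs \<and>
     refutes adj (denials (place ms W) @ placements Ks fs) [(2, 1), (1, 0), (0, 3)] t"

lemma satisfies_place: "satisfies g (place ms W) \<longleftrightarrow> satisfies (\<lambda>i. g (ms ! i)) W"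
  by (induction ms W rule: place.induct) simp_all

lemma denials_sound:
  assumes "satisfies g W" and "V \<in> set (denials W)"
  shows "\<not> satisfies g V"
  using assms by (induction W rule: denials.induct) auto

lemma satisfies_cong:
  assumes "fits n W" and "\<And>i j. i < n \<Longrightarrow> j < n \<Longrightarrow> (g i = g j) = (h i = h j)"
  shows "satisfies g W \<longleftrightarrow> satisfies h W"
  using assms
proof (induction n W rule: fits.induct)
  case (2 n i j b W)
  then have "(g i = g j) = (h i = h j)" by simp
  then show ?case using 2 by simp
qed simp

lemma develop_extends: "\<exists>ws. develop vs fs = vs @ ws"
proof (induction vs fs rule: develop.induct)
  case (2 vs p q r fs)
  then obtain ws where "develop (vs @ [zflip (vs ! p) (vs ! q) (vs ! r)]) fs =
      (vs @ [zflip (vs ! p) (vs ! q) (vs ! r)]) @ ws"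
    by blast
  then show ?case by simp
qed simp

lemma below_iff: "below n ks \<longleftrightarrow> (\<forall>k \<in> set ks. k < n)"
  by (induction n ks rule: below.induct) auto

lemma adjacent_to_iff: "adjacent_to vs v ws \<longleftrightarrow> (\<forall>w \<in> set ws. w < length vs \<and> zadjacent v (vs ! w))"
  by (induction vs v ws rule: adjacent_to.induct) auto

section \<open>Proper colourings of the hyperboloid\<close>

text \<open>The points obtained from \<open>Q\<close> by repeated rotation about \<open>P\<close> through the angle that takes \<open>Q\<close> to \<open>R\<close>.\<close>

fun fan :: "real \<Rightarrow> 'a::real_vector \<Rightarrow> 'a \<Rightarrow> 'a \<Rightarrow> nat \<Rightarrow> 'a" where
  "fan u P Q R 0 = Q"
| "fan u P Q R (Suc i) = fan u P R (u *\<^sub>R (P + R) - Q) i"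

locale proper_colouring =
  fixes u C :: real and f :: "real \<times> real \<times> real \<Rightarrow> nat"
  assumes root: "u ^ 4 + u ^ 3 - 3 * u ^ 2 - u + 1 = 0"
    and C: "(2 - u) * C = u" and u: "u \<noteq> 2"
    and colours: "mink v v = 1 \<Longrightarrow> f v \<in> {1, 2, 3, 4}"
    and proper: "mink v v = 1 \<Longrightarrow> mink w w = 1 \<Longrightarrow> mink v w = C \<Longrightarrow> f v \<noteq> f w"
begin

definition triangle :: "real \<times> real \<times> real \<Rightarrow> real \<times> real \<times> real \<Rightarrow> real \<times> real \<times> real \<Rightarrow> bool" where
  "triangle P Q R \<longleftrightarrow> mink P P = 1 \<and> mink Q Q = 1 \<and> mink R R = 1 \<and>
     mink P Q = C \<and> mink P R = C \<and> mink Q R = C"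

text \<open>
  Quantifying over all triangles is what makes an exclusion reusable: it expresses the homogeneity of
  the plane, and both orientations of a triangle are covered.
\<close>

definition forbidden :: "pattern \<Rightarrow> bool" where
  "forbidden W \<longleftrightarrow> (\<forall>P Q R. triangle P Q R \<longrightarrow> \<not> satisfies (\<lambda>i. f (fan u P Q R i)) W)"

lemma zval_ztimes_u: "zval u (ztimes_u a) = u * zval u a"
proof (cases a)
  case (fields a0 a1 a2 a3)
  have "u ^ 4 = 1 * (- 1 + u + 3 * u ^ 2 - u ^ 3)"
    using root by simp
  then have "real_of_int a3 * u ^ 4 = a3 * (- 1 + u + 3 * u ^ 2 - u ^ 3)"
    by simp
  then show ?thesis
    using fields by (simp add: algebra_simps power2_eq_square power3_eq_cube power4_eq_xxxx)
qed

lemma zval_zmult: "zval u (zmult a b) = zval u a * zval u b"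
  by (cases a) (simp add: zval_zadd zval_zscale zval_ztimes_u algebra_simps
      power2_eq_square power3_eq_cube)

lemma combine_zflip:
  "combine u P Q R (zflip p q r) = u *\<^sub>R (combine u P Q R p + combine u P Q R q) - combine u P Q R r"
  by (cases p; cases q; cases r)
    (simp add: zval_zsub zval_zadd zval_ztimes_u algebra_simps del: ztimes_u.simps zsub.simps zadd.simps)

lemma zform_mink:
  assumes "triangle P Q R"
  shows "zval u (zform p q) = (2 - u) * mink (combine u P Q R p) (combine u P Q R q)"
proof -
  obtain p0 p1 p2 where p: "p = (p0, p1, p2)" by (cases p)
  obtain q0 q1 q2 where q: "q = (q0, q1, q2)" by (cases q)
  define a0 a1 a2 b0 b1 b2 where "a0 = zval u p0" and "a1 = zval u p1" and "a2 = zval u p2"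
    and "b0 = zval u q0" and "b1 = zval u q1" and "b2 = zval u q2"
  note ab = this
  have form: "mink (combine u P Q R p) (combine u P Q R q) = (a0 * b0 + a1 * b1 + a2 * b2) +
      C * ((a0 + a1 + a2) * (b0 + b1 + b2) - (a0 * b0 + a1 * b1 + a2 * b2))"
    using assms mink_commute[of Q P] mink_commute[of R P] mink_commute[of R Q]
    unfolding p q ab triangle_def by (simp add: mink_bilinear algebra_simps)
  have "zval u (zform p q) = (2 - 2 * u) * (a0 * b0 + a1 * b1 + a2 * b2) +
      u * ((a0 + a1 + a2) * (b0 + b1 + b2))"
    unfolding p q ab zform_def zdot.simps zsum.simps zval_zadd zval_zmult zval_ztimes_u
    by (simp add: algebra_simps)
  also have "\<dots> = (2 - u) * (a0 * b0 + a1 * b1 + a2 * b2) +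
      (2 - u) * C * ((a0 + a1 + a2) * (b0 + b1 + b2) - (a0 * b0 + a1 * b1 + a2 * b2))"
    unfolding C by (simp add: algebra_simps)
  finally show ?thesis
    unfolding form by (simp add: algebra_simps)
qed

lemma mink_zunit:
  assumes "triangle P Q R" and "zunit p"
  shows "mink (combine u P Q R p) (combine u P Q R p) = 1"
proof -
  have "(2 - u) * mink (combine u P Q R p) (combine u P Q R p) = (2 - u) * 1"
    using zform_mink[OF assms(1), of p p] assms(2) by (simp add: zunit_def)
  then show ?thesis
    using u by simp
qed

lemma mink_zadjacent:
  assumes "triangle P Q R" and "zadjacent p q"
  shows "mink (combine u P Q R p) (combine u P Q R q) = C"
proof -
  have "(2 - u) * mink (combine u P Q R p) (combine u P Q R q) = (2 - u) * C"
    using zform_mink[OF assms(1), of p q] assms(2) C by (simp add: zadjacent_def)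
  then show ?thesis
    using u by simp
qed

lemma fan_steps_sound:
  assumes "fan_steps p ms" and "2 \<le> length ms" and "i < length ms"
  shows "combine u P Q R (ms ! i) =
    fan u (combine u P Q R p) (combine u P Q R (ms ! 0)) (combine u P Q R (ms ! 1)) i"
  using assms
proof (induction p ms arbitrary: i rule: fan_steps.induct)
  case (1 p a b c ms)
  show ?case
  proof (cases i)
    case (Suc j)
    have c: "c = zflip p b a" "fan_steps p (b # c # ms)"
      using 1(2) by auto
    then show ?thesis
      using 1(1)[OF c(2), of j] 1(4) Suc by (simp add: combine_zflip del: zflip.simps)
  qed simp
next
  case ("2_3" p a b)
  then show ?case
    by (cases i) (auto simp: less_Suc_eq)
qed simp_all

lemma fan_ok_sound:
  assumes tri: "triangle P Q R" and ok: "fan_ok vs p ms W" and units: "list_all zunit vs"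
  defines "L k \<equiv> combine u P Q R (vs ! k)"
  shows "triangle (L p) (L (ms ! 0)) (L (ms ! 1))"
    and "i < length ms \<Longrightarrow> L (ms ! i) = fan u (L p) (L (ms ! 0)) (L (ms ! 1)) i"
proof -
  obtain a b ks where ms: "ms = a # b # ks"
    using ok by (cases "(vs ! p, map ((!) vs) ms)" rule: is_fan.cases) auto
  have bounds: "\<forall>k \<in> set (p # ms). k < length vs"
    using ok below_iff by simp
  then have "mink (L k) (L k) = 1" if "k \<in> set (p # ms)" for k
    unfolding L_def using that units by (intro mink_zunit[OF tri]) (auto simp: list_all_length)
  then show "triangle (L p) (L (ms ! 0)) (L (ms ! 1))"
    using ok unfolding triangle_def ms by (auto simp: L_def intro!: mink_zadjacent[OF tri])
  show "L (ms ! i) = fan u (L p) (L (ms ! 0)) (L (ms ! 1)) i" if "i < length ms"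
  proof -
    have "fan_steps (vs ! p) (map ((!) vs) ms)"
      using ok unfolding ms by simp
    moreover have "2 \<le> length ms"
      unfolding ms by simp
    moreover have "0 < length ms" "1 < length ms"
      by (simp_all add: ms)
    ultimately show ?thesis
      using fan_steps_sound[of "vs ! p" "map ((!) vs) ms" i P Q R] that
      unfolding L_def by (simp only: nth_map length_map)
  qed
qed

lemma fans_ok_sound:
  assumes tri: "triangle P Q R" and units: "list_all zunit vs"
    and known: "\<And>K. K \<in> set Ks \<Longrightarrow> forbidden K"
    and inj: "\<And>k l. k < length vs \<Longrightarrow> l < length vs \<Longrightarrow>
      (g k = g l) = (f (combine u P Q R (vs ! k)) = f (combine u P Q R (vs ! l)))"
    and "fans_ok Ks vs fs" and "W \<in> set (placements Ks fs)"
  shows "\<not> satisfies g W"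
  using assms(5,6)
proof (induction fs)
  case (Cons x fs)
  obtain k p ms where x: "x = (k, p, ms)" by (cases x)
  define L where "L k = combine u P Q R (vs ! k)" for k
  show ?case
  proof (cases "W \<in> set (placements Ks fs)")
    case True
    then show ?thesis using Cons x by simp
  next
    case False
    then have W: "W = place ms (Ks ! k)" and k: "k < length Ks" and ok: "fan_ok vs p ms (Ks ! k)"
      using Cons x by auto
    have bounds: "\<forall>k \<in> set ms. k < length vs"
      using ok below_iff by simp
    have "satisfies (\<lambda>i. g (ms ! i)) (Ks ! k) \<longleftrightarrow>
        satisfies (\<lambda>i. f (fan u (L p) (L (ms ! 0)) (L (ms ! 1)) i)) (Ks ! k)"
    proof (rule satisfies_cong)
      show "fits (length ms) (Ks ! k)" using ok by simp
      fix i j assume "i < length ms" "j < length ms"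
      then show "(g (ms ! i) = g (ms ! j)) =
          (f (fan u (L p) (L (ms ! 0)) (L (ms ! 1)) i) = f (fan u (L p) (L (ms ! 0)) (L (ms ! 1)) j))"
        using fan_ok_sound(2)[OF tri ok units, folded L_def, of i]
          fan_ok_sound(2)[OF tri ok units, folded L_def, of j]
          inj[of "ms ! i" "ms ! j"] bounds by (simp add: L_def)
    qed
    moreover have "forbidden (Ks ! k)"
      using known k by simp
    ultimately show ?thesis
      using fan_ok_sound(1)[OF tri ok units, folded L_def]
      unfolding W satisfies_place forbidden_def by blast
  qed
qed simp

text \<open>
  The vertices \<open>P\<close>, \<open>Q\<close>, \<open>R\<close> of a triangle have three distinct colours, and only one colour is left
  besides them. Renaming the colours accordingly turns \<open>f\<close> on the listed points into a proper colouring
  by 0 to 3 that extends the initial assignment and avoids every pattern in use, which the decision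
  tree refutes.
\<close>

theorem certificate_sound:
  assumes valid: "valid Ks W c" and known: "\<And>K. K \<in> set Ks \<Longrightarrow> forbidden K"
  shows "forbidden W"
  unfolding forbidden_def
proof (intro allI impI notI)
  fix P Q R
  assume tri: "triangle P Q R" and sat: "satisfies (\<lambda>i. f (fan u P Q R i)) W"
  obtain flips adj ms fs t where c: "c = Certificate flips adj ms fs t"
    by (cases c)
  define vs where "vs = develop basis flips"
  have geo: "list_all zunit vs" "list_all2 (adjacent_to vs) vs adj" "take 2 ms = [1, 2]"
      "fan_ok vs 0 ms W" "fans_ok Ks vs fs"
    and ref: "refutes adj (denials (place ms W) @ placements Ks fs) [(2, 1), (1, 0), (0, 3)] t"
    using valid unfolding c vs_def by simp_all
  define L where "L k = combine u P Q R (vs ! k)" for k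
  obtain ws where "vs = basis @ ws"
    using develop_extends vs_def by blast
  then have L012: "L 0 = P" "L 1 = Q" "L 2 = R"
    by (simp_all add: L_def basis_def)
  have "ms = [1, 2] @ drop 2 ms"
    using append_take_drop_id[of 2 ms] unfolding geo(3) by (rule sym)
  then have ms01: "ms ! 0 = 1" "ms ! 1 = 2"
    by (metis append_Cons nth_Cons_0, metis append_Cons nth_Cons_0 nth_Cons_Suc One_nat_def)
  have fan: "L (ms ! i) = fan u P Q R i" if "i < length ms" for i
    using fan_ok_sound(2)[OF tri geo(4,1) that] unfolding L_def[symmetric] ms01 L012 .
  have unit: "mink (L k) (L k) = 1" if "k < length vs" for k
    unfolding L_def using that geo(1) by (intro mink_zunit[OF tri]) (simp add: list_all_length)
  have three: "f P \<in> {1, 2, 3, 4}" "f Q \<in> {1, 2, 3, 4}" "f R \<in> {1, 2, 3, 4}"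
    "f P \<noteq> f Q" "f P \<noteq> f R" "f Q \<noteq> f R"
    using tri colours proper unfolding triangle_def by blast+
  have fourth: "c = c'" if "c \<in> {1, 2, 3, 4} - {f P, f Q, f R}" "c' \<in> {1, 2, 3, 4} - {f P, f Q, f R}"
    for c c'
  proof -
    have "card ({1, 2, 3, 4} - {f P, f Q, f R}) = card {1, 2, 3, 4 :: nat} - card {f P, f Q, f R}"
      using three by (intro card_Diff_subset) auto
    also have "\<dots> = 1"
      using three(4-6) by simp
    finally show ?thesis
      using that by (metis card_1_singletonE singletonD)
  qed
  \<comment> \<open>Colour 2 is a default value: whatever is not a colour of the triangle must be the fourth colour.\<close>
  define g where
    "g k = (if f (L k) = f Q then 0 else if f (L k) = f R then 1 else
      if f (L k) = f P then 3 else 2 :: nat)" for k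
  have inj: "(g k = g l) = (f (L k) = f (L l))" if "k < length vs" "l < length vs" for k l
  proof -
    have "f (L k) \<in> {1, 2, 3, 4}" "f (L l) \<in> {1, 2, 3, 4}"
      using unit colours that by blast+
    then have "f (L k) = f (L l)" if "f (L k) \<notin> {f P, f Q, f R}" "f (L l) \<notin> {f P, f Q, f R}"
      using fourth that by blast
    then show ?thesis
      using three(4-6) unfolding g_def by (auto split: if_splits)
  qed
  show False
  proof (rule refutes_sound[OF ref])
    show "g v \<noteq> g w" if "v < length adj" "w \<in> set (adj ! v)" for v w
    proof -
      have v: "v < length vs"
        using geo(2) that(1) by (simp add: list_all2_lengthD)
      have "adjacent_to vs (vs ! v) (adj ! v)"
        using geo(2) v by (rule list_all2_nthD)
      then have w: "w < length vs" "zadjacent (vs ! v) (vs ! w)"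
        using that(2) adjacent_to_iff by blast+
      have "f (L v) \<noteq> f (L w)"
        using proper unit v w mink_zadjacent[OF tri] unfolding L_def by blast
      then show ?thesis
        using inj v w by blast
    qed
    show "\<not> satisfies g V" if "V \<in> set (denials (place ms W) @ placements Ks fs)" for V
    proof (cases "V \<in> set (placements Ks fs)")
      case True
      then show ?thesis
        using fans_ok_sound[OF tri geo(1) known _ geo(5)] inj unfolding L_def by blast
    next
      case False
      have "satisfies (\<lambda>i. g (ms ! i)) W \<longleftrightarrow> satisfies (\<lambda>i. f (fan u P Q R i)) W"
      proof (rule satisfies_cong)
        show "fits (length ms) W" using geo(4) by simp
        have bounds: "\<forall>k \<in> set ms. k < length vs"
          using geo(4) below_iff by simp
        fix i j assume "i < length ms" "j < length ms"
        then show "(g (ms ! i) = g (ms ! j)) = (f (fan u P Q R i) = f (fan u P Q R j))"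
          using inj[of "ms ! i" "ms ! j"] bounds by (simp add: fan)
      qed
      then have "satisfies g (place ms W)"
        using sat satisfies_place by blast
      then show ?thesis
        using denials_sound that False by auto
    qed
    show "g v < 4" for v
      unfolding g_def by simp
    show "\<forall>v c. (v, c) \<in> set [(2, 1), (1, 0), (0, 3)] \<longrightarrow> g v = c"
    proof -
      have "g 2 = 1" "g 1 = 0" "g 0 = 3"
        unfolding g_def L012 using three(4-6) by simp_all
      then show ?thesis by auto
    qed
  qed
qed

end

section \<open>Excluded words of labels\<close>

text \<open>
  The seed of the argument. Points 14, 18 and 19 of the certificate are the second common neighbours of the
  outer points 0 and 5, 2 and 5, 2 and 7 of the fan; the coincidence that makes everything work is that they
  form a triangle. In the forbidden situation each of them sees the same two colours.
\<close>

definition gadget :: pattern where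
  "gadget = [(0, 2, True), (5, 7, True), (2, 5, False)]"

definition cert_gadget :: certificate where
  "cert_gadget = Certificate
    [(0, 2, 1), (0, 3, 2), (0, 4, 3), (0, 5, 4), (0, 6, 5), (0, 7, 6), (1, 2, 0), (1, 9, 2),
    (1, 10, 9), (1, 11, 10), (1, 12, 11), (1, 13, 12), (14, 13, 1), (14, 15, 13), (16, 14, 15),
    (6, 14, 17), (14, 18, 6)]
    [[], [], [], [0, 2], [], [], [0], [], [0], [], [], [], [], [], [1, 6], [], [], [],
    [3, 6, 14], [3, 8, 14, 18]]
    [1, 2, 3, 4, 5, 6, 7, 8]
    []
    (Split 3 (Split 6 (Clash 2) (Split 8 (Clash 1) (Split 14 (Edge 1) (Edge 6) (Split 18
    (Edge 3) (Edge 6) (Edge 14) (Split 19 (Edge 3) (Edge 8) (Edge 14) (Edge 18))) (Split 18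
    (Edge 3) (Edge 6) (Split 19 (Edge 3) (Edge 8) (Edge 18) (Edge 14)) (Edge 14))) (Clash 1)
    (Edge 0)) (Split 8 (Clash 1) (Clash 1) (Split 14 (Edge 1) (Split 18 (Edge 3) (Edge 14)
    (Edge 6) (Split 19 (Edge 3) (Edge 14) (Edge 8) (Edge 18))) (Edge 6) (Split 18 (Edge 3)
    (Split 19 (Edge 3) (Edge 18) (Edge 8) (Edge 14)) (Edge 6) (Edge 14))) (Edge 0)) (Edge 0))
    (Edge 2) (Clash 0) (Edge 0))"

lemma valid_gadget:
  "valid []
    gadget cert_gadget"
  by code_simp

text \<open>
  The words below are ordered so that each case distinction stays small. By the first two words, two
  adjacent \<open>Eq\<close> are followed by another \<open>Eq\<close> or by \<open>Ne Ne Ne\<close>.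
\<close>

definition cert_eene :: certificate where
  "cert_eene = Certificate
    [(0, 2, 1), (0, 3, 2), (0, 4, 3), (0, 5, 4), (1, 2, 0), (1, 7, 2), (1, 8, 7), (1, 9, 8),
    (1, 10, 9), (1, 11, 10), (1, 12, 11), (13, 12, 1), (12, 11, 1), (12, 15, 11), (16, 12, 15),
    (6, 12, 17), (12, 18, 6), (3, 19, 18), (0, 6, 5), (0, 21, 6), (2, 7, 1), (2, 23, 7),
    (2, 24, 23), (2, 25, 24), (2, 26, 25), (2, 27, 26), (3, 4, 0), (3, 20, 19), (5, 6, 0),
    (5, 31, 6), (5, 32, 31), (5, 33, 32), (5, 34, 33), (5, 35, 34), (0, 22, 21), (0, 37, 22),
    (36, 35, 5), (29, 36, 39), (0, 1, 2), (0, 41, 1), (4, 14, 13), (14, 43, 4), (0, 42, 41),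
    (0, 45, 42), (0, 46, 45), (27, 26, 2), (27, 29, 48), (46, 27, 49), (6, 31, 5), (45, 42, 0),
    (42, 14, 28), (42, 53, 14), (6, 54, 17), (42, 16, 41), (6, 21, 0), (3, 29, 4), (3, 58, 29)]
    [[], [], [], [0, 2], [0, 3], [0, 4], [0, 5], [], [], [], [], [1, 12, 15], [1, 6, 13],
    [1, 4], [4, 12, 13], [12, 21, 22], [17, 41, 42], [6, 12], [3, 6, 12], [3, 12, 18],
    [3, 13, 19], [0, 6], [0, 19, 21], [], [], [], [2, 13, 27, 48], [2, 14, 28, 46],
    [2, 11, 14, 27, 42], [3, 4, 27, 48], [3, 20], [5, 6, 14], [], [], [], [], [5, 19, 29], [],
    [0, 30, 36], [], [29, 30, 36, 38], [0, 1, 42], [0, 14, 41, 45], [4, 14, 18], [14, 31, 43],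
    [0, 44, 46], [0, 44], [0, 46], [26, 27, 29, 47], [27, 29, 46], [27, 41, 46], [6, 31, 45],
    [42, 45, 51], [14, 31, 42], [17, 42, 53], [6, 51, 54], [16, 21, 42], [6, 21, 52, 56], [],
    []]
    [1, 2, 3, 4, 5, 6]
    [(0, 0, [3, 2, 1, 41, 42, 45, 46, 47]), (0, 0, [4, 3, 2, 1, 41, 42, 45, 46]),
    (0, 0, [21, 6, 5, 4, 3, 2, 1, 41]), (0, 3, [0, 4, 29, 58, 59, 30, 20, 19]),
    (0, 6, [18, 12, 17, 54, 55, 51, 31, 5]), (0, 6, [17, 54, 55, 51, 31, 5, 0, 21]),
    (0, 27, [50, 46, 49, 29, 48, 26, 2, 28])]
    (Split 3 (Split 4 (Edge 3) (Split 5 (Clash 2) (Edge 4) (Split 6 (Clash 3) (Split 13 (Edge 1)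
    (Edge 4) (Split 12 (Edge 1) (Edge 6) (Edge 13) (Split 14 (Split 18 (Edge 3) (Edge 6)
    (Split 19 (Edge 3) (Split 20 (Edge 3) (Edge 19) (Edge 13) (Split 21 (Split 22 (Edge 21)
    (Edge 19) (Split 15 (Edge 21) (Split 11 (Edge 1) (Edge 15) (Split 28 (Edge 14) (Edge 2)
    (Edge 11) (Split 27 (Edge 14) (Edge 2) (Split 29 (Edge 3) (Edge 4) (Edge 27) (Split 30
    (Edge 3) (Clash 7) (Split 36 (Split 38 (Edge 36) (Split 40 (Edge 36) (Edge 38) (Edge 30)
    (Edge 29)) (Edge 30) (Edge 0)) (Edge 19) (Edge 5) (Edge 29)) (Edge 20))) (Edge 28)))
    (Edge 12)) (Edge 22) (Edge 12)) (Edge 0)) (Edge 6) (Split 41 (Edge 1) (Clash 6) (Split 42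
    (Edge 14) (Split 22 (Split 15 (Edge 22) (Split 11 (Edge 1) (Edge 15) (Split 28 (Edge 14)
    (Edge 42) (Edge 11) (Split 27 (Edge 14) (Edge 2) (Split 29 (Edge 3) (Edge 4) (Edge 27)
    (Split 30 (Edge 3) (Clash 7) (Split 36 (Split 38 (Edge 36) (Split 40 (Edge 36) (Edge 38)
    (Edge 30) (Edge 29)) (Edge 30) (Edge 0)) (Edge 19) (Edge 5) (Edge 29)) (Edge 20)))
    (Edge 28))) (Edge 12)) (Edge 21) (Edge 12)) (Edge 19) (Edge 21) (Edge 0)) (Edge 41)
    (Edge 0)) (Edge 0)) (Edge 0))) (Edge 18) (Edge 12)) (Edge 12)) (Edge 4) (Edge 13)
    (Edge 12))) (Split 12 (Edge 1) (Edge 6) (Split 14 (Split 18 (Edge 3) (Edge 6) (Edge 12)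
    (Split 43 (Edge 14) (Edge 4) (Split 31 (Edge 14) (Edge 6) (Edge 5) (Split 44 (Edge 14)
    (Split 46 (Split 45 (Edge 46) (Edge 44) (Split 47 (Edge 46) (Split 42 (Edge 14) (Split 41
    (Edge 1) (Edge 42) (Split 27 (Edge 46) (Edge 2) (Split 26 (Split 48 (Edge 26) (Edge 47)
    (Edge 27) (Split 29 (Edge 3) (Edge 4) (Edge 27) (Edge 48))) (Edge 2) (Edge 27) (Edge 13))
    (Split 50 (Edge 46) (Split 28 (Edge 14) (Edge 42) (Split 29 (Edge 3) (Edge 4) (Split 48
    (Split 49 (Edge 46) (Split 26 (Edge 48) (Edge 2) (Clash 10) (Edge 13)) (Edge 29) (Edge 27))
    (Edge 47) (Edge 29) (Edge 27)) (Edge 27)) (Edge 27)) (Edge 41) (Edge 27))) (Edge 0))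
    (Edge 45) (Edge 0)) (Clash 4) (Edge 0)) (Edge 0)) (Edge 44) (Split 45 (Split 42 (Edge 45)
    (Split 41 (Edge 1) (Edge 42) (Split 51 (Edge 45) (Edge 6) (Split 52 (Edge 45) (Edge 42)
    (Edge 51) (Split 53 (Edge 14) (Edge 42) (Split 17 (Split 54 (Edge 17) (Edge 42) (Edge 53)
    (Split 16 (Edge 17) (Edge 42) (Edge 41) (Split 55 (Split 21 (Split 56 (Edge 21) (Edge 42)
    (Split 57 (Edge 21) (Edge 6) (Edge 56) (Edge 52)) (Edge 16)) (Edge 6) (Clash 9) (Edge 0))
    (Edge 6) (Edge 51) (Edge 54)))) (Edge 6) (Edge 12) (Clash 8)) (Edge 31))) (Edge 31))
    (Edge 0)) (Clash 5) (Edge 0)) (Edge 44) (Edge 46) (Edge 0)) (Edge 0)) (Edge 43) (Edge 31)))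
    (Edge 18))) (Edge 4) (Edge 12) (Edge 13)) (Edge 13))) (Edge 5) (Edge 0)) (Edge 0)) (Clash 1)
    (Edge 0)) (Edge 2) (Clash 0) (Edge 0))"

lemma valid_eene:
  "valid [gadget]
    (labels [Eq, Eq, Ne, Eq]) cert_eene"
  by code_simp

definition cert_eenne :: certificate where
  "cert_eenne = Certificate
    [(0, 2, 1), (0, 3, 2), (0, 4, 3), (0, 5, 4), (0, 6, 5), (0, 1, 2), (0, 8, 1), (2, 3, 0),
    (2, 10, 3), (2, 11, 10), (2, 12, 11), (2, 13, 12), (2, 14, 13), (2, 15, 14), (16, 15, 2),
    (3, 10, 2), (3, 18, 10), (3, 19, 18), (3, 20, 19), (3, 21, 20), (3, 22, 21), (0, 9, 8),
    (15, 14, 2), (15, 25, 14), (26, 15, 25), (7, 15, 27), (15, 28, 7), (1, 26, 8), (1, 30, 26),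
    (1, 31, 30), (1, 32, 31), (1, 33, 32), (34, 33, 1), (4, 29, 28), (2, 16, 15), (0, 24, 9),
    (0, 38, 24), (0, 39, 38), (0, 40, 39), (40, 39, 0), (39, 38, 0), (39, 43, 38), (3, 4, 0)]
    [[], [], [], [0, 2], [0, 3], [0, 4], [0, 5], [0, 6], [0, 1], [0, 8], [2, 3, 29], [], [], [],
    [], [2, 7, 16], [2, 5], [8, 15, 16], [3, 10, 19], [3, 20, 36, 37], [3, 19, 21],
    [3, 16, 20, 22], [3, 17, 23], [3, 8, 17], [0, 9, 22], [], [], [], [4, 7, 15], [4, 15, 28],
    [], [], [], [1, 23, 34], [1, 10, 22], [10, 33, 34], [4, 16, 29], [2, 16, 36], [0, 24, 39],
    [0, 40], [0, 18, 35], [0, 35, 40], [18, 39, 40], [21, 22, 39], [4, 39, 43], [3, 4, 42, 44]]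
    [1, 2, 3, 4, 5, 6, 7]
    [(0, 0, [7, 6, 5, 4, 3, 2, 1, 8]), (0, 3, [22, 21, 20, 19, 18, 10, 2, 0]),
    (1, 0, [41, 40, 39, 38, 24, 9]), (1, 0, [4, 3, 2, 1, 8, 9]), (1, 0, [1, 2, 3, 4, 5, 6])]
    (Split 3 (Split 4 (Edge 3) (Split 5 (Clash 2) (Edge 4) (Split 6 (Split 7 (Edge 6) (Clash 4)
    (Split 8 (Edge 1) (Clash 5) (Split 9 (Clash 8) (Split 16 (Split 15 (Edge 16) (Edge 2)
    (Edge 7) (Split 17 (Edge 16) (Split 23 (Edge 3) (Edge 17) (Edge 8) (Split 22 (Edge 3)
    (Edge 17) (Split 24 (Split 28 (Split 29 (Edge 28) (Edge 4) (Split 10 (Edge 3) (Edge 2)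
    (Edge 29) (Split 34 (Edge 1) (Split 33 (Edge 1) (Edge 34) (Split 35 (Split 36 (Edge 16)
    (Edge 4) (Edge 29) (Split 37 (Edge 16) (Edge 2) (Split 19 (Edge 3) (Split 18 (Edge 3)
    (Edge 19) (Split 40 (Edge 35) (Split 41 (Edge 35) (Edge 40) (Split 20 (Edge 3) (Edge 19)
    (Clash 6) (Split 21 (Edge 3) (Split 39 (Split 42 (Edge 39) (Edge 40) (Edge 18) (Split 43
    (Edge 39) (Edge 21) (Edge 22) (Split 44 (Edge 39) (Edge 4) (Split 45 (Edge 3) (Edge 4)
    (Edge 44) (Edge 42)) (Edge 43)))) (Edge 40) (Split 38 (Edge 24) (Clash 7) (Edge 39)
    (Edge 0)) (Edge 0)) (Edge 22) (Edge 20))) (Edge 0)) (Edge 18) (Edge 0)) (Edge 10)) (Edge 37)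
    (Edge 36)) (Edge 36))) (Edge 34) (Edge 33) (Edge 10)) (Edge 23)) (Edge 22) (Edge 10)))
    (Edge 15)) (Edge 4) (Edge 7) (Edge 15)) (Edge 9) (Edge 22) (Edge 0)) (Edge 23))) (Edge 8)
    (Edge 15))) (Edge 2) (Edge 5) (Split 15 (Split 17 (Edge 15) (Split 23 (Edge 3) (Edge 17)
    (Edge 8) (Split 22 (Edge 3) (Edge 17) (Split 24 (Split 21 (Edge 3) (Split 28 (Edge 15)
    (Edge 4) (Edge 7) (Split 29 (Edge 15) (Edge 4) (Split 10 (Edge 3) (Edge 2) (Edge 29)
    (Split 34 (Edge 1) (Split 20 (Edge 3) (Edge 21) (Clash 6) (Split 33 (Edge 1) (Edge 34)
    (Split 35 (Split 36 (Split 37 (Edge 36) (Edge 2) (Split 19 (Edge 3) (Split 18 (Edge 3)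
    (Edge 19) (Split 40 (Edge 35) (Split 41 (Edge 35) (Edge 40) (Split 39 (Split 42 (Edge 39)
    (Edge 40) (Edge 18) (Split 43 (Edge 39) (Edge 21) (Edge 22) (Split 44 (Edge 39) (Edge 4)
    (Split 45 (Edge 3) (Edge 4) (Edge 44) (Edge 42)) (Edge 43)))) (Edge 40) (Split 38 (Edge 24)
    (Clash 7) (Edge 39) (Edge 0)) (Edge 0)) (Edge 0)) (Edge 18) (Edge 0)) (Edge 10)) (Edge 37)
    (Edge 20)) (Edge 16)) (Edge 4) (Edge 29) (Edge 16)) (Edge 34) (Edge 33) (Edge 10))
    (Edge 23))) (Edge 22) (Edge 10))) (Edge 28))) (Edge 22) (Edge 16)) (Edge 9) (Edge 22)
    (Edge 0)) (Edge 23))) (Edge 8) (Edge 16)) (Edge 2) (Edge 7) (Edge 16))) (Edge 8) (Edge 0))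
    (Edge 0)) (Edge 0)) (Clash 9) (Edge 5) (Edge 0)) (Edge 0)) (Clash 1) (Edge 0)) (Edge 2)
    (Clash 0) (Edge 0))"

lemma valid_eenne:
  "valid [gadget, labels [Eq, Eq, Ne, Eq]]
    (labels [Eq, Eq, Ne, Ne, Eq]) cert_eenne"
  by code_simp

text \<open>
  This bounds the runs of \<open>Eq\<close>, and the two words after it bound the runs of \<open>Ne\<close> next to \<open>Eq Eq\<close>. The
  longer one comes first because its extra \<open>Ne\<close> fixes more colours at the outset.
\<close>

definition cert_eeee :: certificate where
  "cert_eeee = Certificate
    [(0, 2, 1), (0, 3, 2), (0, 4, 3), (0, 5, 4), (1, 2, 0), (1, 7, 2), (1, 8, 7), (1, 9, 8),
    (1, 10, 9), (1, 11, 10), (1, 12, 11), (13, 12, 1), (12, 11, 1), (12, 15, 11), (16, 12, 15),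
    (6, 12, 17), (12, 18, 6), (3, 19, 18), (4, 14, 13), (0, 1, 2), (0, 22, 1), (0, 23, 22),
    (22, 1, 0), (22, 25, 1), (22, 26, 25), (22, 27, 26), (22, 28, 27), (22, 29, 28),
    (22, 30, 29), (31, 30, 22), (4, 5, 0), (0, 24, 23), (5, 33, 4), (34, 24, 0), (0, 6, 5),
    (0, 37, 6), (0, 38, 37), (2, 3, 0), (2, 40, 3), (2, 41, 40), (2, 42, 41), (2, 43, 42),
    (2, 44, 43), (45, 44, 2), (25, 45, 46), (37, 45, 47), (45, 48, 37), (0, 39, 38),
    (39, 50, 0), (7, 19, 51), (38, 19, 52), (36, 14, 21), (14, 54, 36), (23, 14, 55),
    (23, 16, 22), (6, 37, 0), (6, 58, 37), (6, 59, 58), (6, 60, 59), (6, 61, 60), (6, 62, 61),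
    (6, 63, 62), (1, 25, 22), (1, 65, 25), (1, 66, 65), (1, 67, 66), (1, 68, 67), (1, 69, 68)]
    [[], [], [], [0, 2], [0, 3], [0, 4], [0, 5], [], [], [], [], [1, 12, 15], [1, 6, 13],
    [1, 4], [4, 12, 13], [12, 16, 37, 38], [12], [6, 12, 16], [3, 6, 12], [3, 12, 18],
    [3, 13, 19], [4, 14, 18], [0, 1, 23], [0, 14, 56], [0, 23], [1, 22, 26], [15, 22, 38], [],
    [], [22, 30, 58], [5, 22, 31], [3, 22], [24, 30, 31], [4, 5, 32], [0, 24], [5, 33, 34],
    [21, 24, 34, 35], [0, 6, 38], [0, 19, 37, 53], [0, 38], [2, 3, 49, 69], [2, 40, 50], [], [],
    [], [2, 25, 30, 37], [], [25, 37, 45, 64], [4, 37, 45], [4, 40, 45, 48], [0, 39],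
    [19, 20, 41, 50], [], [5, 17, 19], [], [], [2, 11, 14], [16, 23, 37], [6, 37, 57], [], [],
    [], [], [6, 33, 49], [6, 49, 63], [], [], [], [], [1, 32, 70], [24, 29, 32]]
    [1, 2, 3, 4, 5, 6]
    [(0, 0, [5, 4, 3, 2, 1, 22, 23, 24]), (0, 0, [37, 6, 5, 4, 3, 2, 1, 22]),
    (0, 0, [39, 38, 37, 6, 5, 4, 3, 2]), (0, 12, [1, 11, 15, 16, 17, 6, 18, 19]),
    (0, 12, [14, 13, 1, 11, 15, 16, 17, 6]), (1, 12, [14, 13, 1, 11, 15, 16]),
    (1, 12, [19, 18, 6, 17, 16, 15])]
    (Split 3 (Split 4 (Edge 3) (Split 5 (Split 6 (Edge 5) (Split 13 (Edge 1) (Edge 4) (Split 12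
    (Edge 1) (Edge 6) (Edge 13) (Split 14 (Split 18 (Edge 3) (Edge 6) (Split 19 (Edge 3)
    (Split 20 (Edge 3) (Edge 19) (Edge 13) (Split 21 (Edge 14) (Edge 4) (Edge 18) (Split 23
    (Edge 14) (Split 22 (Edge 1) (Edge 23) (Split 24 (Split 31 (Edge 3) (Split 30 (Edge 5)
    (Edge 31) (Edge 22) (Split 32 (Edge 24) (Edge 31) (Split 33 (Edge 5) (Edge 4) (Edge 32)
    (Split 34 (Edge 24) (Split 35 (Edge 5) (Edge 34) (Split 36 (Edge 24) (Edge 34) (Edge 35)
    (Edge 21)) (Edge 33)) (Split 35 (Edge 5) (Split 36 (Edge 24) (Edge 35) (Edge 34) (Edge 21))
    (Edge 34) (Edge 33)) (Edge 0))) (Edge 30))) (Edge 22) (Split 30 (Edge 5) (Split 32 (Edge 24)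
    (Edge 30) (Split 33 (Edge 5) (Edge 4) (Edge 32) (Split 34 (Edge 24) (Split 35 (Edge 5)
    (Edge 34) (Split 36 (Edge 24) (Edge 34) (Edge 35) (Edge 21)) (Edge 33)) (Split 35 (Edge 5)
    (Split 36 (Edge 24) (Edge 35) (Edge 34) (Edge 21)) (Edge 34) (Edge 33)) (Edge 0)))
    (Edge 31)) (Edge 22) (Edge 31))) (Edge 23) (Clash 4) (Edge 0)) (Edge 0)) (Split 22 (Edge 1)
    (Split 37 (Clash 5) (Edge 6) (Split 38 (Split 39 (Edge 38) (Split 45 (Split 48 (Edge 45)
    (Edge 4) (Edge 37) (Split 49 (Edge 45) (Edge 4) (Split 40 (Edge 3) (Edge 2) (Edge 49)
    (Split 50 (Split 41 (Edge 50) (Edge 2) (Split 51 (Edge 50) (Edge 19) (Edge 41) (Edge 20))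
    (Edge 40)) (Edge 39) (Split 41 (Split 51 (Edge 41) (Edge 19) (Edge 50) (Edge 20)) (Edge 2)
    (Edge 50) (Edge 40)) (Edge 0))) (Edge 48))) (Edge 2) (Edge 37) (Split 48 (Split 49 (Edge 48)
    (Edge 4) (Split 40 (Edge 3) (Edge 2) (Edge 49) (Split 50 (Split 41 (Edge 50) (Edge 2)
    (Split 51 (Edge 50) (Edge 19) (Edge 41) (Edge 20)) (Edge 40)) (Edge 39) (Split 41 (Split 51
    (Edge 41) (Edge 19) (Edge 50) (Edge 20)) (Edge 2) (Edge 50) (Edge 40)) (Edge 0))) (Edge 45))
    (Edge 4) (Edge 37) (Edge 45))) (Clash 6) (Edge 0)) (Edge 19) (Edge 37) (Edge 0)) (Edge 0))
    (Edge 23) (Edge 0)) (Edge 0)))) (Edge 18) (Edge 12)) (Edge 12)) (Edge 4) (Edge 13)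
    (Edge 12))) (Split 12 (Edge 1) (Edge 6) (Split 14 (Split 18 (Edge 3) (Edge 6) (Edge 12)
    (Split 19 (Edge 3) (Split 16 (Split 17 (Edge 16) (Edge 6) (Edge 12) (Split 53 (Edge 5)
    (Edge 19) (Split 38 (Split 37 (Edge 38) (Edge 6) (Split 15 (Edge 38) (Split 11 (Edge 1)
    (Edge 15) (Edge 12) (Split 56 (Edge 14) (Edge 2) (Split 23 (Edge 14) (Split 22 (Edge 1)
    (Edge 23) (Split 24 (Split 57 (Edge 16) (Edge 23) (Edge 37) (Split 26 (Edge 38) (Edge 15)
    (Edge 22) (Split 25 (Edge 1) (Split 58 (Split 31 (Edge 3) (Split 30 (Edge 5) (Edge 31)
    (Edge 22) (Split 32 (Edge 24) (Edge 31) (Split 45 (Split 48 (Edge 45) (Edge 4) (Edge 37)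
    (Split 49 (Edge 45) (Edge 4) (Split 33 (Edge 5) (Edge 4) (Edge 32) (Split 63 (Split 64
    (Edge 63) (Edge 6) (Edge 49) (Split 47 (Edge 45) (Edge 25) (Edge 37) (Edge 64))) (Edge 6)
    (Edge 49) (Edge 33))) (Edge 48))) (Edge 25) (Edge 37) (Edge 30)) (Edge 30))) (Edge 22)
    (Split 30 (Edge 5) (Split 32 (Edge 24) (Edge 30) (Split 29 (Edge 58) (Edge 30) (Edge 22)
    (Split 70 (Edge 24) (Split 69 (Edge 1) (Edge 70) (Edge 32) (Split 40 (Edge 3) (Edge 2)
    (Split 45 (Split 48 (Edge 45) (Edge 4) (Edge 37) (Split 49 (Edge 45) (Edge 4) (Edge 40)
    (Edge 48))) (Edge 30) (Edge 37) (Split 48 (Split 49 (Edge 48) (Edge 4) (Edge 40) (Edge 45))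
    (Edge 4) (Edge 37) (Edge 45))) (Edge 69))) (Edge 32) (Edge 29))) (Edge 31)) (Edge 22)
    (Edge 31))) (Edge 6) (Edge 37) (Edge 57)) (Edge 22) (Edge 26)))) (Edge 23) (Clash 4)
    (Edge 0)) (Edge 0)) (Edge 56) (Edge 0)) (Edge 11))) (Edge 37) (Clash 10)) (Edge 0))
    (Edge 19) (Edge 53) (Edge 0)) (Edge 17))) (Clash 8) (Edge 12) (Split 15 (Clash 7) (Split 11
    (Edge 1) (Edge 15) (Edge 12) (Clash 9)) (Edge 12) (Edge 16))) (Edge 12) (Edge 18))) (Edge 4)
    (Edge 12) (Edge 13)) (Edge 13))) (Clash 3) (Edge 0)) (Edge 4) (Clash 2) (Edge 0)) (Clash 1)
    (Edge 0)) (Edge 2) (Clash 0) (Edge 0))"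

lemma valid_eeee:
  "valid [gadget, labels [Eq, Eq, Ne, Eq]]
    (labels [Eq, Eq, Eq, Eq]) cert_eeee"
  by code_simp

definition cert_eennnnn :: certificate where
  "cert_eennnnn = Certificate
    [(0, 2, 1), (0, 3, 2), (0, 4, 3), (0, 5, 4), (0, 6, 5), (0, 7, 6), (0, 8, 7), (1, 2, 0),
    (3, 4, 0), (3, 11, 4), (3, 12, 11), (3, 13, 12), (3, 14, 13), (3, 15, 14), (16, 15, 3),
    (4, 11, 3), (4, 18, 11), (4, 19, 18), (4, 20, 19), (4, 21, 20), (4, 22, 21), (22, 23, 4),
    (1, 24, 23), (1, 25, 24), (10, 16, 17), (8, 16, 27), (16, 28, 8), (2, 3, 0), (2, 30, 3),
    (0, 9, 8), (32, 31, 17), (32, 14, 33), (4, 5, 0), (4, 35, 5), (4, 36, 35), (4, 37, 36),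
    (4, 38, 37), (4, 39, 38), (40, 39, 4), (2, 31, 30), (2, 42, 31), (2, 43, 42), (2, 44, 43),
    (2, 45, 44), (46, 45, 2), (0, 1, 2), (48, 1, 0), (8, 9, 0), (7, 8, 0), (24, 51, 25),
    (0, 48, 1), (30, 40, 41), (9, 43, 54), (1, 10, 2), (2, 10, 1), (2, 57, 10), (43, 42, 2),
    (57, 58, 2), (48, 49, 1), (48, 61, 49), (48, 62, 61), (48, 63, 62), (48, 47, 64),
    (65, 47, 48), (1, 49, 48), (1, 67, 49), (1, 68, 67), (1, 69, 68), (1, 70, 69)]
    [[], [], [], [0, 2], [0, 3], [0, 4], [0, 5], [0, 6], [0, 7], [0, 8], [1, 2], [], [], [],
    [3, 15, 32], [3, 16, 17], [3, 8, 10], [9, 10, 16], [], [], [], [], [4, 23, 24], [1, 4, 15],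
    [1, 16, 23], [1, 24], [1, 8, 25], [10, 16, 26], [5, 16], [5, 16, 28], [2, 3, 31],
    [2, 17, 30, 32], [0, 9, 17, 31], [14, 31, 32], [14, 29, 32], [], [], [], [], [4, 40, 41],
    [4, 9, 30], [30, 32, 40], [2, 31, 43, 59], [9, 54], [], [2, 40, 46], [2, 5, 39],
    [5, 45, 46], [0, 1, 47, 52, 53], [1, 45, 48], [8, 9, 45, 49, 56], [7, 8, 24, 25],
    [24, 48, 51, 53], [0, 22, 52], [9, 30, 40], [9, 43], [1, 10, 55], [2, 10], [2, 15, 57],
    [17, 42, 43, 60], [17, 57, 58, 59], [], [], [], [], [3, 47, 48], [3, 47, 65], [], [], [],
    [1, 42, 65, 71], [1, 30, 66]]
    [1, 2, 3, 4, 5, 6, 7, 8, 9]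
    [(0, 2, [57, 10, 1, 0, 3, 30, 31, 42]), (0, 9, [54, 43, 55, 56, 50, 8, 0, 32]),
    (1, 0, [1, 2, 3, 4, 5, 6]), (1, 2, [42, 31, 30, 3, 0, 1]), (1, 9, [32, 0, 8, 50, 56, 55]),
    (1, 32, [9, 17, 31, 33, 14, 34]), (1, 16, [28, 8, 27, 10, 17, 15]),
    (2, 0, [1, 2, 3, 4, 5, 6, 7]), (2, 2, [43, 42, 31, 30, 3, 0, 1]),
    (2, 32, [0, 9, 17, 31, 33, 14, 34]), (3, 2, [1, 0, 3, 30, 31, 42]),
    (3, 24, [22, 23, 1, 25, 51, 52])]
    (Split 3 (Split 4 (Edge 3) (Split 5 (Clash 2) (Edge 4) (Split 6 (Split 7 (Edge 6) (Split 8
    (Clash 5) (Edge 7) (Split 9 (Split 10 (Edge 1) (Edge 2) (Split 16 (Edge 3) (Split 17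
    (Edge 9) (Edge 16) (Edge 10) (Split 15 (Edge 3) (Edge 16) (Split 23 (Edge 1) (Edge 4)
    (Edge 15) (Split 24 (Edge 1) (Edge 16) (Split 22 (Split 25 (Edge 1) (Split 26 (Edge 1)
    (Edge 25) (Edge 8) (Split 27 (Split 28 (Clash 13) (Edge 16) (Edge 5) (Split 29 (Split 31
    (Split 32 (Edge 9) (Split 14 (Edge 3) (Edge 32) (Edge 15) (Split 33 (Edge 31) (Edge 32)
    (Split 34 (Edge 29) (Edge 32) (Clash 16) (Edge 14)) (Edge 14))) (Split 14 (Edge 3) (Split 33
    (Edge 31) (Edge 14) (Edge 32) (Split 34 (Edge 29) (Edge 14) (Edge 32) (Clash 12))) (Edge 32)
    (Split 33 (Edge 31) (Split 34 (Edge 29) (Clash 16) (Edge 32) (Edge 14)) (Edge 32)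
    (Edge 14))) (Edge 0)) (Edge 2) (Split 32 (Edge 9) (Split 30 (Edge 3) (Edge 2) (Edge 31)
    (Split 40 (Edge 9) (Edge 4) (Split 41 (Split 39 (Edge 41) (Edge 4) (Edge 40) (Split 46
    (Split 45 (Edge 46) (Edge 2) (Edge 40) (Split 47 (Edge 46) (Split 48 (Edge 1) (Edge 47)
    (Split 49 (Edge 1) (Split 50 (Edge 9) (Edge 49) (Edge 8) (Edge 45)) (Edge 48) (Edge 45))
    (Edge 0)) (Edge 5) (Edge 45))) (Edge 2) (Edge 5) (Edge 39))) (Edge 32) (Edge 40) (Edge 30))
    (Edge 30))) (Edge 31) (Edge 0)) (Edge 17)) (Edge 16) (Edge 5) (Edge 28))) (Edge 16)
    (Edge 10) (Edge 26))) (Edge 24) (Split 51 (Split 52 (Edge 51) (Split 53 (Edge 22) (Edge 52)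
    (Split 48 (Edge 1) (Edge 52) (Edge 53) (Edge 0)) (Edge 0)) (Edge 24) (Clash 18)) (Edge 7)
    (Edge 24) (Edge 25))) (Edge 4) (Edge 24) (Edge 23)) (Edge 23))) (Edge 17))) (Edge 10)
    (Split 17 (Edge 9) (Split 32 (Edge 9) (Edge 17) (Split 15 (Edge 3) (Edge 17) (Split 30
    (Edge 3) (Edge 2) (Split 40 (Edge 9) (Edge 4) (Edge 30) (Split 54 (Edge 9) (Split 43
    (Edge 9) (Edge 54) (Split 55 (Edge 9) (Clash 8) (Edge 43) (Split 56 (Edge 1) (Split 50
    (Edge 9) (Edge 56) (Edge 8) (Clash 11)) (Edge 10) (Edge 55))) (Split 57 (Split 42 (Split 58
    (Edge 57) (Edge 2) (Edge 15) (Split 59 (Edge 42) (Edge 17) (Split 60 (Edge 57) (Edge 17)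
    (Edge 59) (Edge 58)) (Edge 43))) (Edge 2) (Clash 7) (Edge 43)) (Edge 2) (Edge 10) (Split 58
    (Split 60 (Edge 58) (Edge 17) (Split 59 (Split 42 (Edge 59) (Edge 2) (Split 31 (Clash 10)
    (Edge 17) (Edge 32) (Clash 15)) (Edge 43)) (Edge 17) (Edge 60) (Edge 43)) (Edge 57))
    (Edge 2) (Edge 15) (Edge 57)))) (Edge 30) (Edge 40))) (Split 31 (Split 42 (Edge 31) (Edge 2)
    (Split 40 (Edge 9) (Edge 4) (Split 46 (Split 45 (Edge 46) (Edge 2) (Edge 40) (Split 47
    (Edge 46) (Split 48 (Edge 1) (Edge 47) (Split 65 (Edge 3) (Edge 47) (Edge 48) (Split 66
    (Edge 3) (Edge 47) (Split 71 (Edge 1) (Split 70 (Edge 1) (Edge 71) (Edge 42) (Edge 65))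
    (Edge 66) (Edge 30)) (Edge 65))) (Edge 0)) (Edge 5) (Edge 45))) (Edge 2) (Edge 5) (Split 45
    (Split 47 (Edge 45) (Split 48 (Edge 1) (Edge 47) (Split 65 (Edge 3) (Edge 47) (Edge 48)
    (Split 66 (Edge 3) (Edge 47) (Split 71 (Edge 1) (Split 70 (Edge 1) (Edge 71) (Edge 42)
    (Edge 65)) (Edge 66) (Edge 30)) (Edge 65))) (Edge 0)) (Edge 5) (Edge 46)) (Edge 2) (Edge 40)
    (Edge 46))) (Edge 30)) (Clash 17)) (Edge 17) (Edge 32) (Edge 30))) (Edge 16)) (Edge 0))
    (Edge 10) (Edge 16))) (Split 16 (Edge 3) (Split 17 (Edge 9) (Edge 16) (Split 15 (Edge 3)
    (Edge 16) (Edge 17) (Split 23 (Edge 1) (Edge 4) (Split 24 (Edge 1) (Edge 16) (Edge 23)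
    (Split 22 (Split 51 (Split 53 (Edge 22) (Split 48 (Edge 1) (Edge 53) (Split 52 (Edge 51)
    (Edge 53) (Edge 48) (Edge 24)) (Edge 0)) (Split 48 (Edge 1) (Split 52 (Edge 51) (Edge 48)
    (Edge 53) (Edge 24)) (Edge 53) (Edge 0)) (Edge 0)) (Edge 7) (Edge 8) (Edge 24)) (Edge 4)
    (Edge 23) (Edge 24))) (Edge 15))) (Edge 10)) (Edge 8) (Edge 10))) (Clash 6) (Edge 8)
    (Edge 0)) (Edge 0)) (Clash 14) (Edge 0)) (Clash 9) (Edge 5) (Edge 0)) (Edge 0)) (Clash 1)
    (Edge 0)) (Edge 2) (Clash 0) (Edge 0))"

lemma valid_eennnnn:
  "valid [gadget, labels [Eq, Eq, Ne, Eq], labels [Eq, Eq, Ne, Ne, Eq], labels [Eq, Eq, Eq, Eq]]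
    (labels [Eq, Eq, Ne, Ne, Ne, Ne, Ne]) cert_eennnnn"
  by code_simp

definition cert_eennnn :: certificate where
  "cert_eennnn = Certificate
    [(0, 2, 1), (0, 3, 2), (0, 4, 3), (0, 5, 4), (0, 6, 5), (0, 7, 6), (0, 8, 7), (1, 2, 0),
    (1, 10, 2), (2, 3, 0), (2, 12, 3), (2, 13, 12), (2, 14, 13), (2, 15, 14), (8, 9, 0),
    (9, 11, 17), (9, 15, 18), (0, 9, 8), (9, 20, 0), (2, 16, 15), (2, 22, 16), (23, 22, 2),
    (3, 12, 2), (3, 25, 12), (3, 26, 25), (3, 27, 26), (3, 28, 27), (3, 29, 28), (29, 28, 3),
    (31, 29, 28), (29, 32, 31), (29, 33, 32), (34, 29, 33), (35, 29, 34), (1, 36, 35),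
    (3, 4, 0), (3, 38, 4), (3, 39, 38), (3, 40, 39), (3, 41, 40), (3, 42, 41), (36, 37, 1),
    (0, 1, 2), (0, 45, 1), (0, 34, 46), (0, 47, 34), (0, 48, 47), (1, 11, 10), (1, 50, 11),
    (1, 51, 50), (1, 52, 51), (1, 53, 52), (54, 53, 1), (2, 10, 1), (2, 56, 10), (2, 57, 56),
    (2, 58, 57), (2, 59, 58), (48, 49, 0), (40, 39, 3), (27, 26, 3), (0, 20, 9), (20, 64, 0),
    (2, 23, 22), (66, 23, 2), (9, 19, 15), (0, 64, 20), (0, 69, 64), (64, 39, 65), (64, 71, 39),
    (64, 72, 71), (64, 73, 72), (64, 74, 73), (9, 68, 19), (69, 70, 0), (74, 75, 64),
    (8, 75, 78), (79, 75, 8), (6, 74, 76)]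
    [[], [], [], [0, 2], [0, 3], [0, 4], [0, 5], [0, 6], [0, 7], [0, 8], [1, 2, 11], [1, 9],
    [2, 3, 13], [2, 12, 14, 20, 21], [2, 13, 15], [2, 14, 16, 19], [2, 15, 17, 22],
    [8, 9, 11, 16], [9, 11, 15], [9, 12, 15, 68], [0, 9, 13], [9, 10, 13, 20], [2, 16, 17],
    [2, 5, 22], [5, 22, 23], [3, 12, 49], [3, 25], [3, 26], [], [3, 24, 30], [3, 16, 24], [],
    [4, 5, 74], [], [], [], [1, 12, 29], [1, 30, 36], [3, 4, 39], [3, 38, 64, 65], [3, 39], [],
    [], [3, 10, 21], [12, 36, 37], [], [], [], [], [0, 44], [], [], [], [1, 43, 54], [1, 4],
    [4, 53, 54], [], [], [], [], [2, 38, 55], [38, 49, 60], [39, 40, 61], [26, 27, 61, 62],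
    [0, 20, 39], [12, 20, 39, 64, 68], [2, 23, 26], [4, 23, 26, 65, 66, 68], [4, 12, 22],
    [0, 64], [0, 69], [], [], [32, 64, 74], [64, 68, 75, 76], [8, 19, 64], [9, 68],
    [32, 69, 70, 74], [], [8, 18, 75], [18, 20, 75, 79], [6, 74, 77]]
    [1, 2, 3, 4, 5, 6, 7, 8]
    [(0, 2, [1, 0, 3, 12, 13, 14, 15, 16]), (0, 3, [29, 28, 27, 26, 25, 12, 2, 0]),
    (0, 9, [19, 15, 18, 11, 17, 8, 0, 20]), (1, 0, [1, 2, 3, 4, 5, 6]),
    (1, 0, [7, 8, 9, 20, 64, 69]), (1, 0, [8, 9, 20, 64, 69, 70]),
    (1, 2, [0, 3, 12, 13, 14, 15]), (1, 2, [1, 0, 3, 12, 13, 14]),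
    (1, 2, [10, 1, 0, 3, 12, 13]), (1, 3, [38, 4, 0, 2, 12, 25]), (1, 3, [4, 0, 2, 12, 25, 26]),
    (1, 3, [12, 2, 0, 4, 38, 39]), (1, 9, [8, 17, 11, 18, 15, 19]),
    (1, 9, [0, 8, 17, 11, 18, 15]), (1, 68, [67, 65, 12, 19, 9, 76]),
    (2, 0, [1, 2, 3, 4, 5, 6, 7]), (2, 0, [7, 8, 9, 20, 64, 69, 70]),
    (2, 2, [1, 0, 3, 12, 13, 14, 15]), (2, 2, [10, 1, 0, 3, 12, 13, 14]),
    (2, 3, [38, 4, 0, 2, 12, 25, 26]), (2, 3, [12, 2, 0, 4, 38, 39, 40]),
    (2, 9, [0, 8, 17, 11, 18, 15, 19]), (3, 0, [69, 64, 20, 9, 8, 7]),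
    (3, 2, [1, 0, 3, 12, 13, 14]), (3, 2, [10, 1, 0, 3, 12, 13]), (3, 3, [26, 25, 12, 2, 0, 4]),
    (3, 3, [12, 2, 0, 4, 38, 39]), (3, 9, [15, 18, 11, 17, 8, 0]),
    (4, 0, [1, 2, 3, 4, 5, 6, 7, 8, 9]), (4, 2, [10, 1, 0, 3, 12, 13, 14, 15, 16]),
    (4, 9, [76, 68, 19, 15, 18, 11, 17, 8, 0]), (4, 9, [21, 20, 0, 8, 17, 11, 18, 15, 19]),
    (4, 74, [68, 76, 6, 81, 77, 32, 73, 64, 75])]
    (Split 3 (Split 4 (Edge 3) (Split 5 (Clash 2) (Edge 4) (Split 6 (Split 7 (Edge 6) (Split 8
    (Clash 5) (Edge 7) (Split 9 (Clash 34) (Split 11 (Edge 1) (Edge 9) (Split 10 (Edge 1)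
    (Edge 2) (Edge 11) (Split 12 (Edge 3) (Edge 2) (Split 13 (Clash 14) (Edge 2) (Edge 12)
    (Split 14 (Split 15 (Edge 14) (Edge 2) (Split 16 (Split 17 (Edge 16) (Edge 9) (Edge 11)
    (Split 18 (Clash 19) (Edge 9) (Edge 11) (Clash 33))) (Edge 2) (Edge 15) (Clash 35))
    (Split 18 (Split 19 (Split 17 (Clash 18) (Edge 9) (Edge 11) (Clash 27)) (Edge 9) (Edge 12)
    (Edge 15)) (Edge 9) (Edge 11) (Edge 15))) (Edge 2) (Clash 24) (Edge 13))) (Split 13
    (Clash 30) (Edge 2) (Split 20 (Split 21 (Edge 20) (Edge 9) (Edge 13) (Edge 10)) (Edge 9)
    (Edge 13) (Edge 0)) (Edge 12)))) (Split 10 (Edge 1) (Edge 2) (Split 17 (Split 20 (Split 21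
    (Edge 20) (Edge 9) (Edge 10) (Split 13 (Edge 20) (Edge 2) (Split 12 (Edge 3) (Edge 2)
    (Edge 13) (Split 14 (Split 15 (Edge 14) (Edge 2) (Clash 23) (Split 16 (Edge 17) (Edge 2)
    (Split 22 (Edge 17) (Edge 2) (Edge 16) (Split 23 (Split 24 (Edge 23) (Split 30 (Edge 3)
    (Edge 24) (Edge 16) (Split 29 (Edge 3) (Edge 24) (Split 36 (Edge 1) (Split 37 (Edge 1)
    (Edge 36) (Split 43 (Edge 3) (Split 44 (Split 49 (Edge 44) (Split 25 (Edge 3) (Edge 49)
    (Split 26 (Edge 3) (Split 27 (Edge 3) (Edge 26) (Clash 7) (Split 38 (Edge 3) (Edge 4)
    (Split 39 (Edge 3) (Clash 17) (Edge 38) (Split 40 (Edge 3) (Split 54 (Edge 1) (Edge 4)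
    (Split 53 (Edge 1) (Edge 43) (Edge 54) (Split 55 (Split 60 (Edge 55) (Edge 2) (Edge 38)
    (Split 61 (Split 62 (Edge 61) (Edge 40) (Split 63 (Edge 61) (Edge 26) (Edge 62) (Edge 27))
    (Edge 39)) (Edge 49) (Edge 38) (Edge 60))) (Edge 4) (Edge 54) (Edge 53))) (Split 53 (Edge 1)
    (Edge 43) (Split 55 (Split 60 (Edge 55) (Edge 2) (Edge 38) (Split 61 (Split 62 (Edge 61)
    (Edge 40) (Split 63 (Edge 61) (Edge 26) (Edge 62) (Edge 27)) (Edge 39)) (Edge 49) (Edge 38)
    (Edge 60))) (Edge 4) (Edge 53) (Edge 54)) (Edge 54))) (Clash 26) (Edge 39))) (Split 39
    (Edge 3) (Clash 32) (Split 64 (Edge 20) (Split 65 (Edge 20) (Edge 64) (Edge 39) (Edge 12))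
    (Edge 39) (Edge 0)) (Edge 38)))) (Edge 25) (Clash 16)) (Edge 12)) (Split 25 (Edge 3)
    (Split 26 (Edge 3) (Edge 25) (Split 66 (Edge 23) (Edge 2) (Edge 26) (Split 67 (Edge 23)
    (Edge 4) (Edge 26) (Edge 66))) (Clash 31)) (Edge 49) (Edge 12)) (Edge 0)) (Edge 36)
    (Edge 37) (Edge 12)) (Edge 10) (Edge 21)) (Edge 30)) (Edge 29) (Edge 12)) (Edge 30)))
    (Edge 5) (Edge 22)) (Edge 2) (Edge 5) (Edge 22))) (Edge 15))) (Edge 2) (Edge 13)
    (Clash 13))) (Edge 21))) (Edge 9) (Split 12 (Edge 3) (Edge 2) (Split 22 (Edge 17) (Edge 2)
    (Split 16 (Edge 17) (Edge 2) (Edge 22) (Split 68 (Split 19 (Edge 68) (Edge 9) (Edge 12)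
    (Split 64 (Split 69 (Edge 64) (Split 70 (Clash 22) (Edge 69) (Split 75 (Edge 64) (Split 15
    (Split 18 (Edge 15) (Edge 9) (Split 76 (Edge 68) (Edge 9) (Split 74 (Edge 68) (Edge 75)
    (Edge 76) (Split 32 (Split 77 (Edge 32) (Edge 69) (Edge 70) (Edge 74)) (Edge 4) (Edge 5)
    (Edge 74))) (Clash 36)) (Edge 11)) (Edge 2) (Split 18 (Split 79 (Edge 18) (Edge 75) (Edge 8)
    (Split 80 (Edge 18) (Edge 75) (Edge 20) (Edge 79))) (Edge 9) (Edge 15) (Edge 11)) (Edge 19))
    (Edge 8) (Edge 19)) (Edge 0)) (Clash 10) (Edge 0)) (Split 69 (Split 70 (Edge 69) (Clash 11)
    (Split 75 (Split 65 (Edge 68) (Edge 64) (Edge 20) (Split 39 (Edge 3) (Edge 64) (Split 38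
    (Edge 3) (Edge 4) (Edge 39) (Split 25 (Edge 3) (Clash 15) (Edge 12) (Split 26 (Edge 3)
    (Split 67 (Edge 68) (Edge 26) (Split 76 (Edge 68) (Edge 9) (Split 74 (Edge 68) (Edge 64)
    (Edge 76) (Split 32 (Split 73 (Edge 32) (Edge 64) (Split 77 (Edge 32) (Split 81 (Edge 6)
    (Edge 77) (Clash 38) (Edge 74)) (Edge 70) (Edge 74)) (Edge 74)) (Edge 4) (Edge 5)
    (Edge 74))) (Clash 20)) (Edge 65)) (Clash 25) (Edge 25)))) (Edge 65))) (Edge 64) (Edge 8)
    (Edge 19)) (Edge 0)) (Edge 64) (Clash 28) (Edge 0)) (Edge 20) (Edge 0))) (Edge 4) (Edge 22)
    (Split 19 (Split 15 (Edge 19) (Edge 2) (Split 18 (Clash 8) (Edge 9) (Edge 15) (Edge 11))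
    (Edge 16)) (Edge 9) (Edge 12) (Edge 68)))) (Split 16 (Edge 17) (Edge 2) (Split 68 (Split 19
    (Edge 68) (Edge 9) (Edge 12) (Split 15 (Split 14 (Edge 15) (Edge 2) (Clash 6) (Split 13
    (Split 21 (Edge 13) (Edge 9) (Edge 10) (Split 18 (Edge 15) (Edge 9) (Clash 37) (Edge 11)))
    (Edge 2) (Edge 20) (Edge 14))) (Edge 2) (Edge 16) (Edge 19))) (Edge 4) (Edge 12) (Edge 22))
    (Edge 22))) (Split 13 (Split 14 (Edge 13) (Edge 2) (Split 16 (Edge 17) (Edge 2) (Clash 6)
    (Split 15 (Clash 12) (Edge 2) (Edge 14) (Edge 16))) (Clash 29)) (Edge 2) (Edge 20)
    (Edge 12))) (Edge 0)) (Edge 9) (Edge 8) (Edge 11)) (Edge 11))) (Edge 8) (Edge 0)) (Edge 0))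
    (Clash 21) (Edge 0)) (Clash 9) (Edge 5) (Edge 0)) (Edge 0)) (Clash 1) (Edge 0)) (Edge 2)
    (Clash 0) (Edge 0))"

lemma valid_eennnn:
  "valid [gadget, labels [Eq, Eq, Ne, Eq], labels [Eq, Eq, Ne, Ne, Eq], labels [Eq, Eq, Eq, Eq],
     labels [Eq, Eq, Ne, Ne, Ne, Ne, Ne]]
    (labels [Eq, Eq, Ne, Ne, Ne, Ne]) cert_eennnn"
  by code_simp

text \<open>
  Now every run of at least two \<open>Eq\<close> is surrounded by \<open>Ne Ne Ne Eq\<close> on each side, which leaves so little
  freedom that first runs of three and then runs of two can be excluded.
\<close>

definition cert_eee :: certificate where
  "cert_eee = Certificate
    [(0, 2, 1), (0, 3, 2), (0, 4, 3), (0, 1, 2), (0, 6, 1), (0, 7, 6), (0, 8, 7), (0, 5, 4),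
    (0, 10, 5), (6, 1, 0), (6, 12, 1), (6, 13, 12), (6, 14, 13), (6, 15, 14), (6, 16, 15),
    (6, 17, 16), (18, 17, 6), (8, 7, 0), (17, 16, 6), (20, 17, 21), (4, 5, 0), (5, 23, 4),
    (9, 8, 0), (8, 20, 7), (8, 26, 20), (8, 27, 26), (8, 28, 27), (5, 10, 0)]
    [[], [], [], [0, 2], [0, 3], [0, 4], [0, 1], [0, 6], [0, 7], [0, 8], [0, 5], [0, 10], [],
    [], [], [], [6, 17, 21], [5, 6, 18], [3, 6], [8, 17, 18], [7, 8, 17, 26], [10, 11, 17],
    [5, 17, 20, 28], [4, 5, 19], [5, 9, 23], [8, 9, 24], [8, 10, 30], [8, 26], [8, 29],
    [8, 19, 23], [5, 10, 25]]
    [1, 2, 3, 4, 5]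
    [(0, 0, [5, 4, 3, 2, 1, 6, 7, 8]), (1, 0, [4, 3, 2, 1, 6, 7]), (1, 0, [2, 3, 4, 5, 10, 11]),
    (2, 8, [25, 9, 0, 7, 20, 26, 27]), (3, 0, [5, 4, 3, 2, 1, 6]), (3, 0, [10, 5, 4, 3, 2, 1]),
    (4, 0, [4, 3, 2, 1, 6, 7, 8, 9]), (4, 8, [19, 29, 28, 27, 26, 20, 7, 0]),
    (4, 17, [19, 18, 6, 16, 21, 20, 22, 5])]
    (Split 3 (Split 4 (Edge 3) (Split 5 (Split 6 (Edge 1) (Clash 7) (Split 7 (Clash 4) (Split 8
    (Split 9 (Edge 8) (Split 10 (Edge 5) (Clash 8) (Split 11 (Clash 5) (Split 18 (Edge 3)
    (Split 17 (Edge 5) (Edge 18) (Edge 6) (Split 19 (Edge 8) (Edge 18) (Split 20 (Edge 8)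
    (Edge 7) (Split 22 (Edge 5) (Split 21 (Split 16 (Edge 21) (Clash 11) (Edge 6) (Edge 17))
    (Edge 11) (Edge 10) (Edge 17)) (Edge 20) (Edge 17)) (Edge 17)) (Edge 17))) (Edge 6)
    (Split 17 (Edge 5) (Split 19 (Edge 8) (Edge 17) (Split 23 (Edge 5) (Edge 4) (Edge 19)
    (Split 24 (Edge 5) (Edge 9) (Split 25 (Edge 8) (Edge 9) (Edge 24) (Split 29 (Edge 8)
    (Split 30 (Edge 5) (Split 26 (Edge 8) (Edge 30) (Edge 10) (Split 20 (Edge 8) (Edge 7)
    (Split 27 (Edge 8) (Split 28 (Edge 8) (Edge 29) (Clash 10) (Split 22 (Edge 5) (Edge 17)
    (Edge 20) (Edge 28))) (Clash 6) (Edge 26)) (Edge 26))) (Edge 10) (Edge 25)) (Edge 19)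
    (Edge 23))) (Edge 23))) (Edge 18)) (Edge 6) (Edge 18))) (Edge 10) (Edge 0)) (Edge 0))
    (Clash 9) (Edge 0)) (Edge 7) (Clash 3) (Edge 0)) (Edge 6) (Edge 0)) (Edge 0)) (Edge 4)
    (Clash 2) (Edge 0)) (Clash 1) (Edge 0)) (Edge 2) (Clash 0) (Edge 0))"

lemma valid_eee:
  "valid [gadget, labels [Eq, Eq, Ne, Eq], labels [Eq, Eq, Ne, Ne, Eq], labels [Eq, Eq, Eq, Eq],
     labels [Eq, Eq, Ne, Ne, Ne, Ne]]
    (labels [Eq, Eq, Eq]) cert_eee"
  by code_simp

definition cert_ee :: certificate where
  "cert_ee = Certificate
    [(0, 2, 1), (0, 3, 2), (0, 1, 2), (0, 5, 1), (0, 6, 5), (0, 7, 6), (0, 4, 3), (0, 9, 4),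
    (0, 10, 9), (0, 11, 10), (7, 6, 0), (10, 11, 0), (11, 14, 10), (11, 15, 14), (11, 16, 15),
    (11, 17, 16), (11, 18, 17), (19, 18, 11), (20, 19, 18), (19, 21, 20), (2, 19, 22),
    (23, 19, 2), (24, 14, 13), (5, 24, 25), (26, 24, 5), (13, 24, 14), (9, 28, 24), (7, 13, 6),
    (7, 30, 13), (7, 29, 31), (4, 9, 0), (27, 33, 32), (34, 27, 33), (9, 33, 4), (9, 36, 33),
    (0, 8, 7), (7, 27, 32), (39, 27, 7), (38, 34, 8), (38, 41, 34), (38, 42, 41), (38, 43, 42),
    (38, 40, 44), (45, 40, 38), (2, 3, 0), (40, 47, 44), (27, 24, 26), (9, 10, 0), (24, 19, 23),
    (1, 40, 39), (0, 38, 8), (3, 4, 0), (3, 47, 2), (3, 55, 47), (6, 13, 7), (6, 57, 13),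
    (6, 58, 57), (6, 46, 45), (0, 53, 38), (7, 39, 27), (5, 20, 1), (5, 63, 20)]
    [[], [], [], [0, 2], [0, 3], [0, 1], [0, 5], [0, 6], [0, 7], [0, 4], [0, 9], [0, 10],
    [0, 11], [6, 7], [10, 11, 13], [6, 14], [11, 15], [5, 11, 16, 25], [11, 17, 19],
    [2, 18, 23, 24], [1, 5], [12, 19, 20], [2, 19, 21], [2, 9, 24], [5, 13, 14, 23, 26],
    [5, 14, 24], [3, 5, 24], [7, 24, 26, 32, 33], [9, 13, 24], [7, 9, 28, 31], [7, 13, 50],
    [7, 29, 30], [7, 27, 29], [4, 9, 32, 36], [8, 27, 33, 35, 38], [3, 23, 27, 34], [8, 9],
    [9, 29, 36], [0, 8, 34], [7, 27, 40], [1, 27, 38], [4, 34, 38], [], [38, 44], [38, 40, 47],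
    [6, 38, 40], [6, 40, 45, 60, 61], [2, 3, 40, 48], [40, 47, 52, 53, 61], [24, 27, 31, 37],
    [9, 10], [16, 19, 24], [1, 26, 40], [0, 38], [3, 4, 41], [3, 53], [3, 43, 55], [6, 13, 58],
    [6, 25, 57, 59, 62], [6, 58, 60], [6, 39, 46, 59], [0, 53], [7, 39], [], []]
    [1, 2, 3, 4]
    [(0, 38, [0, 8, 34, 41, 42, 43, 44, 40]), (0, 6, [46, 60, 59, 58, 57, 13, 7, 0]),
    (0, 5, [0, 1, 20, 63, 64, 17, 25, 24]), (0, 40, [46, 45, 38, 44, 47, 48, 52, 1]),
    (1, 0, [61, 53, 38, 8, 7, 6]), (1, 0, [4, 3, 2, 1, 5, 6]), (1, 0, [1, 2, 3, 4, 9, 10]),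
    (1, 7, [8, 0, 6, 13, 30, 31]), (1, 7, [31, 30, 13, 6, 0, 8]),
    (1, 7, [62, 39, 27, 32, 29, 31]), (1, 6, [59, 58, 57, 13, 7, 0]),
    (1, 6, [0, 7, 13, 57, 58, 59]), (1, 3, [54, 4, 0, 2, 47, 55]),
    (1, 11, [12, 0, 10, 14, 15, 16]), (1, 40, [45, 38, 44, 47, 48, 52]),
    (1, 40, [48, 47, 44, 38, 45, 46]), (1, 27, [49, 24, 26, 3, 35, 34]),
    (1, 24, [51, 19, 23, 9, 28, 13]), (1, 24, [49, 27, 26, 5, 25, 14]),
    (2, 0, [4, 3, 2, 1, 5, 6, 7]), (2, 0, [1, 2, 3, 4, 9, 10, 11]),
    (2, 6, [0, 7, 13, 57, 58, 59, 60]), (3, 0, [6, 7, 8, 38, 53]), (3, 0, [4, 3, 2, 1, 5]),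
    (3, 0, [9, 4, 3, 2, 1]), (3, 7, [8, 0, 6, 13, 30]), (3, 6, [58, 57, 13, 7, 0]),
    (3, 3, [47, 2, 0, 4, 54]), (3, 11, [15, 14, 10, 0, 12]), (3, 40, [38, 44, 47, 48, 52]),
    (3, 40, [46, 45, 38, 44, 47]), (3, 27, [34, 35, 3, 26, 24]), (3, 24, [13, 28, 9, 23, 19]),
    (3, 24, [26, 5, 25, 14, 13]), (4, 0, [4, 3, 2, 1, 5, 6, 7, 8]),
    (4, 0, [1, 2, 3, 4, 9, 10, 11, 12]), (4, 7, [8, 0, 6, 13, 30, 31, 29, 32]),
    (4, 6, [0, 7, 13, 57, 58, 59, 60, 46]), (4, 3, [54, 4, 0, 2, 47, 55, 56, 43]),
    (4, 9, [28, 29, 37, 36, 33, 4, 0, 10]), (4, 9, [29, 37, 36, 33, 4, 0, 10, 50]),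
    (4, 11, [12, 0, 10, 14, 15, 16, 17, 18]), (4, 27, [7, 32, 33, 34, 35, 3, 26, 24]),
    (4, 24, [26, 5, 25, 14, 13, 28, 9, 23]), (4, 24, [23, 9, 28, 13, 14, 25, 5, 26]),
    (4, 19, [11, 18, 20, 21, 22, 2, 23, 24])]
    (Split 3 (Split 4 (Edge 3) (Split 5 (Edge 1) (Clash 25) (Split 6 (Clash 7) (Split 7 (Split 8
    (Edge 7) (Split 9 (Clash 26) (Edge 4) (Split 10 (Split 11 (Edge 10) (Split 12 (Split 13
    (Edge 7) (Edge 6) (Split 14 (Edge 10) (Edge 11) (Edge 13) (Split 15 (Clash 30) (Edge 6)
    (Split 16 (Split 17 (Edge 16) (Edge 11) (Edge 5) (Split 18 (Split 23 (Split 24 (Edge 23)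
    (Split 26 (Edge 3) (Edge 24) (Edge 5) (Split 27 (Edge 7) (Edge 24) (Split 25 (Split 28
    (Clash 46) (Edge 24) (Edge 13) (Split 29 (Edge 7) (Split 32 (Edge 7) (Edge 29) (Edge 27)
    (Split 33 (Split 34 (Edge 33) (Edge 8) (Edge 27) (Split 35 (Edge 3) (Clash 44) (Edge 27)
    (Edge 34))) (Edge 4) (Edge 9) (Edge 32))) (Edge 9) (Edge 28))) (Edge 24) (Edge 5) (Edge 14))
    (Edge 26))) (Edge 13) (Edge 14)) (Edge 2) (Edge 9) (Split 19 (Edge 18) (Edge 2) (Split 24
    (Split 28 (Edge 24) (Split 29 (Edge 7) (Edge 28) (Edge 9) (Split 36 (Split 33 (Edge 36)
    (Edge 4) (Edge 9) (Split 37 (Edge 36) (Split 27 (Edge 7) (Split 35 (Edge 3) (Edge 27)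
    (Split 34 (Split 38 (Edge 34) (Edge 8) (Split 40 (Edge 1) (Edge 27) (Edge 38) (Split 45
    (Split 46 (Edge 45) (Edge 6) (Split 47 (Edge 3) (Edge 2) (Split 48 (Clash 5) (Split 44
    (Clash 32) (Clash 17) (Edge 38) (Edge 40)) (Edge 47) (Edge 40)) (Edge 40)) (Edge 40))
    (Edge 6) (Edge 38) (Edge 40))) (Edge 0)) (Edge 8) (Edge 35) (Edge 33)) (Edge 23)) (Split 34
    (Split 35 (Edge 34) (Split 26 (Edge 3) (Clash 33) (Edge 5) (Split 49 (Edge 24) (Edge 37)
    (Edge 27) (Clash 18))) (Edge 27) (Edge 23)) (Edge 8) (Edge 27) (Edge 33)) (Edge 33))
    (Edge 9) (Edge 29))) (Edge 8) (Edge 9) (Split 33 (Split 37 (Split 50 (Edge 10) (Clash 42)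
    (Edge 9) (Split 30 (Edge 7) (Split 31 (Edge 7) (Edge 30) (Clash 10) (Edge 29)) (Edge 13)
    (Edge 50))) (Clash 41) (Edge 9) (Edge 36)) (Edge 4) (Edge 9) (Edge 36)))) (Edge 13)
    (Clash 34)) (Split 28 (Split 51 (Edge 16) (Edge 24) (Edge 19) (Clash 19)) (Edge 24)
    (Edge 13) (Clash 34)) (Edge 13) (Edge 23)) (Edge 23))) (Edge 11) (Clash 43) (Edge 17)))
    (Edge 11) (Edge 15) (Clash 15)) (Edge 14))) (Split 30 (Edge 7) (Clash 27) (Split 31 (Edge 7)
    (Split 29 (Edge 7) (Edge 31) (Edge 9) (Split 32 (Edge 7) (Split 14 (Edge 10) (Edge 11)
    (Split 26 (Edge 3) (Split 24 (Split 23 (Edge 24) (Edge 2) (Edge 9) (Split 19 (Edge 24)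
    (Edge 2) (Split 28 (Edge 24) (Split 25 (Edge 24) (Clash 45) (Edge 5) (Split 17 (Split 20
    (Edge 1) (Split 18 (Edge 17) (Edge 11) (Edge 19) (Split 21 (Edge 12) (Edge 20) (Edge 19)
    (Split 22 (Clash 47) (Edge 2) (Edge 19) (Edge 21)))) (Edge 5) (Clash 4)) (Edge 11) (Edge 5)
    (Edge 25))) (Edge 9) (Edge 13)) (Edge 23))) (Edge 26) (Edge 5) (Edge 13)) (Edge 5) (Split 27
    (Edge 7) (Edge 32) (Split 24 (Split 25 (Edge 24) (Split 49 (Edge 24) (Edge 31) (Edge 27)
    (Clash 20)) (Edge 5) (Clash 35)) (Split 25 (Split 40 (Edge 1) (Split 39 (Edge 7) (Edge 40)
    (Edge 27) (Split 52 (Edge 1) (Edge 40) (Split 38 (Split 53 (Edge 38) (Clash 24) (Split 34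
    (Edge 38) (Edge 8) (Edge 27) (Split 41 (Edge 38) (Edge 4) (Split 54 (Edge 3) (Edge 4)
    (Edge 41) (Split 47 (Edge 3) (Edge 40) (Split 55 (Edge 3) (Clash 14) (Edge 53) (Split 44
    (Edge 38) (Edge 40) (Edge 47) (Split 43 (Edge 38) (Clash 2) (Split 56 (Edge 3) (Clash 40)
    (Edge 43) (Edge 55)) (Edge 44)))) (Clash 29))) (Edge 34))) (Edge 0)) (Edge 8) (Split 53
    (Split 48 (Edge 53) (Edge 40) (Edge 52) (Split 47 (Edge 3) (Edge 40) (Split 44 (Split 45
    (Clash 16) (Edge 40) (Edge 38) (Split 57 (Split 58 (Edge 57) (Edge 6) (Split 59 (Clash 13)
    (Edge 6) (Edge 58) (Split 60 (Split 46 (Edge 60) (Edge 40) (Clash 39) (Edge 45)) (Edge 6)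
    (Clash 23) (Edge 59))) (Clash 28)) (Edge 6) (Split 58 (Edge 25) (Edge 6) (Edge 57) (Split 59
    (Split 60 (Edge 59) (Edge 6) (Split 46 (Clash 3) (Edge 40) (Edge 60) (Edge 45)) (Edge 39))
    (Edge 6) (Clash 12) (Edge 58))) (Edge 13))) (Edge 40) (Edge 38) (Clash 31)) (Edge 48)))
    (Split 61 (Split 48 (Edge 61) (Edge 53) (Edge 52) (Split 47 (Edge 3) (Edge 40) (Split 44
    (Split 45 (Clash 16) (Edge 40) (Edge 38) (Split 46 (Edge 61) (Edge 40) (Split 60 (Split 59
    (Edge 60) (Edge 6) (Clash 3) (Split 58 (Edge 25) (Edge 6) (Split 57 (Clash 39) (Edge 6)
    (Edge 58) (Edge 13)) (Edge 59))) (Edge 6) (Edge 46) (Edge 39)) (Edge 45))) (Edge 40)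
    (Edge 38) (Clash 31)) (Edge 48))) (Edge 53) (Clash 6) (Edge 0)) (Edge 38) (Edge 0))
    (Edge 0)) (Edge 26))) (Edge 27) (Split 39 (Edge 7) (Split 62 (Edge 7) (Edge 39) (Clash 11)
    (Split 58 (Edge 25) (Edge 6) (Split 57 (Split 59 (Clash 13) (Edge 6) (Edge 58) (Split 60
    (Split 46 (Edge 60) (Edge 6) (Clash 39) (Edge 40)) (Edge 6) (Clash 23) (Edge 59))) (Edge 6)
    (Edge 58) (Edge 13)) (Edge 62))) (Edge 27) (Edge 40))) (Edge 24) (Edge 5) (Clash 35))
    (Edge 5) (Edge 13)) (Edge 26))) (Edge 13)) (Clash 38) (Edge 29))) (Edge 30) (Clash 9))
    (Edge 13))) (Edge 11) (Clash 37) (Edge 0)) (Clash 22) (Edge 0)) (Clash 8) (Edge 9) (Edge 0))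
    (Edge 0)) (Clash 36) (Edge 0)) (Edge 6) (Clash 21) (Edge 0)) (Edge 5) (Edge 0)) (Edge 0))
    (Clash 1) (Edge 0)) (Edge 2) (Clash 0) (Edge 0))"

lemma valid_ee:
  "valid [gadget, labels [Eq, Eq, Ne, Eq], labels [Eq, Eq, Ne, Ne, Eq], labels [Eq, Eq, Eq],
     labels [Eq, Eq, Ne, Ne, Ne, Ne]]
    (labels [Eq, Eq]) cert_ee"
  by code_simp

text \<open>
  Without two adjacent \<open>Eq\<close>, an edge labelled \<open>Eq\<close> forces the label \<open>Ne\<close> on the next edge to either side
  at both of its ends. Together with the gadget this suffices to exclude it.
\<close>

definition cert_e :: certificate where
  "cert_e = Certificate
    [(0, 2, 1), (0, 1, 2), (0, 3, 2), (1, 2, 0), (2, 3, 0), (0, 4, 1), (0, 8, 4), (9, 8, 0),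
    (9, 10, 8), (9, 11, 10), (9, 12, 11), (9, 13, 12), (9, 14, 13), (9, 15, 14), (16, 15, 9),
    (15, 14, 9), (15, 18, 14), (19, 15, 18), (3, 15, 20), (15, 21, 3), (2, 6, 1), (1, 17, 16),
    (17, 24, 1), (17, 7, 25), (17, 26, 7), (0, 9, 8), (0, 27, 28), (0, 29, 27), (0, 5, 3),
    (27, 26, 17), (27, 17, 26), (33, 17, 27)]
    [[], [], [], [0, 2], [0, 1], [0, 3], [1, 2], [2, 3], [0, 4], [0, 8, 15, 16], [], [], [], [],
    [9, 15, 18, 33], [3, 9, 16, 18, 21], [1, 9, 15, 17], [1, 7, 15, 16, 24, 25, 27],
    [5, 14, 15, 19, 31], [15, 18, 20, 27], [3, 15, 19], [3, 4, 15], [4, 15, 21, 31], [2, 6, 25],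
    [1, 17, 21, 25], [7, 17, 23, 24], [7, 17, 27, 32], [0, 17, 19, 26, 29, 32, 33], [],
    [0, 25, 27, 30], [0, 23, 25], [0, 5], [3, 20, 27], [8, 14, 17, 27, 34], [8, 17, 30]]
    [1, 2, 3]
    [(0, 0, [1, 4, 8, 9, 28, 27, 29, 30]), (0, 0, [31, 5, 3, 2, 1, 4, 8, 9]),
    (0, 15, [9, 14, 18, 19, 20, 3, 21, 22]), (1, 0, [1, 4, 8, 9]), (1, 0, [3, 2, 1, 4]),
    (1, 0, [5, 3, 2, 1]), (1, 30, [0, 29, 25, 23]), (1, 29, [25, 30, 0, 27]),
    (1, 27, [32, 26, 17, 33]), (1, 2, [1, 0, 3, 7]), (1, 2, [6, 1, 0, 3]),
    (1, 5, [3, 0, 31, 18]), (1, 17, [33, 27, 26, 7]), (1, 17, [26, 7, 25, 24]),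
    (1, 17, [25, 24, 1, 16]), (1, 17, [7, 25, 24, 1]), (1, 26, [7, 17, 27, 32]),
    (1, 15, [20, 3, 21, 22]), (1, 15, [9, 14, 18, 19]), (1, 15, [16, 9, 14, 18]),
    (1, 15, [14, 18, 19, 20]), (1, 15, [18, 19, 20, 3]), (1, 15, [17, 16, 9, 14]),
    (1, 15, [19, 20, 3, 21]), (1, 21, [4, 22, 15, 3]), (1, 20, [32, 3, 15, 19])]
    (Split 3 (Split 4 (Edge 1) (Clash 5) (Split 5 (Edge 3) (Clash 6) (Split 6 (Edge 1) (Edge 2)
    (Split 7 (Edge 3) (Edge 2) (Split 8 (Split 9 (Edge 8) (Split 16 (Edge 1) (Edge 9) (Split 15
    (Edge 3) (Edge 9) (Edge 16) (Split 17 (Edge 1) (Split 14 (Split 21 (Edge 3) (Split 22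
    (Split 18 (Edge 14) (Clash 3) (Edge 5) (Edge 15)) (Edge 21) (Edge 4) (Edge 15)) (Edge 4)
    (Edge 15)) (Edge 9) (Clash 23) (Edge 15)) (Edge 16) (Edge 15))) (Split 17 (Edge 1) (Split 23
    (Split 25 (Edge 23) (Edge 17) (Edge 7) (Split 24 (Edge 1) (Edge 17) (Split 26 (Split 27
    (Edge 26) (Edge 17) (Split 30 (Edge 23) (Split 29 (Clash 7) (Edge 30) (Edge 27) (Edge 0))
    (Clash 1) (Edge 0)) (Edge 0)) (Edge 17) (Edge 7) (Clash 14)) (Edge 25))) (Edge 2) (Edge 6)
    (Split 25 (Split 24 (Edge 1) (Edge 17) (Clash 16) (Clash 15)) (Edge 17) (Edge 7) (Edge 23)))
    (Edge 7) (Edge 16))) (Clash 4) (Edge 0)) (Split 31 (Split 9 (Split 18 (Edge 31) (Split 15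
    (Edge 9) (Edge 18) (Split 14 (Edge 9) (Edge 18) (Edge 15) (Split 19 (Split 20 (Edge 3)
    (Clash 22) (Edge 15) (Split 32 (Edge 3) (Split 27 (Edge 19) (Edge 32) (Split 33 (Split 17
    (Edge 1) (Clash 17) (Edge 27) (Split 26 (Clash 13) (Edge 32) (Edge 27) (Edge 17))) (Edge 8)
    (Edge 27) (Edge 14)) (Edge 0)) (Clash 26) (Edge 20))) (Edge 18) (Edge 15) (Split 20 (Edge 3)
    (Clash 21) (Edge 15) (Edge 19)))) (Split 21 (Edge 3) (Split 22 (Edge 31) (Edge 21) (Edge 4)
    (Edge 15)) (Edge 4) (Edge 15))) (Edge 5) (Clash 12)) (Edge 8) (Clash 2) (Edge 0)) (Split 21
    (Edge 3) (Split 15 (Edge 3) (Edge 21) (Split 9 (Split 14 (Edge 9) (Split 24 (Edge 1)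
    (Edge 21) (Split 25 (Clash 16) (Split 17 (Edge 1) (Edge 25) (Edge 15) (Split 26 (Split 16
    (Edge 9) (Split 18 (Clash 20) (Edge 14) (Edge 15) (Split 30 (Split 29 (Edge 30) (Edge 25)
    (Split 27 (Edge 26) (Split 34 (Edge 30) (Edge 8) (Split 33 (Split 32 (Edge 3) (Edge 27)
    (Split 19 (Clash 26) (Edge 27) (Edge 15) (Edge 18)) (Clash 9)) (Edge 27) (Edge 34)
    (Edge 17)) (Edge 17)) (Edge 29) (Edge 0)) (Edge 0)) (Edge 25) (Split 29 (Split 34 (Split 33
    (Edge 34) (Edge 8) (Split 27 (Edge 29) (Split 19 (Split 20 (Edge 3) (Clash 24) (Edge 15)
    (Clash 22)) (Edge 27) (Edge 15) (Edge 18)) (Edge 33) (Edge 0)) (Edge 17)) (Edge 8) (Edge 30)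
    (Edge 17)) (Edge 25) (Edge 30) (Edge 0)) (Edge 0))) (Edge 15) (Edge 17)) (Clash 14) (Edge 7)
    (Edge 17))) (Edge 24) (Split 23 (Split 17 (Edge 1) (Split 26 (Split 27 (Edge 26) (Edge 17)
    (Split 30 (Edge 23) (Split 29 (Clash 7) (Edge 30) (Edge 27) (Edge 0)) (Clash 8) (Edge 0))
    (Edge 0)) (Edge 17) (Edge 7) (Clash 14)) (Edge 15) (Edge 25)) (Edge 2) (Edge 6) (Edge 25)))
    (Split 17 (Edge 1) (Split 25 (Split 16 (Edge 9) (Edge 17) (Edge 15) (Clash 15)) (Edge 17)
    (Edge 7) (Edge 24)) (Edge 15) (Edge 24))) (Edge 15) (Split 18 (Split 19 (Edge 18) (Split 16
    (Edge 9) (Split 17 (Edge 1) (Edge 16) (Edge 15) (Split 24 (Edge 1) (Edge 21) (Split 25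
    (Clash 16) (Split 26 (Split 27 (Edge 26) (Edge 19) (Split 33 (Clash 13) (Edge 8) (Edge 27)
    (Edge 14)) (Edge 0)) (Clash 14) (Edge 7) (Edge 17)) (Edge 24) (Edge 17)) (Edge 17)))
    (Edge 15) (Clash 20)) (Edge 15) (Clash 19)) (Edge 31) (Edge 15) (Edge 14))) (Edge 8)
    (Edge 15) (Edge 0)) (Split 17 (Edge 1) (Split 16 (Edge 1) (Edge 17) (Split 9 (Split 22
    (Split 20 (Edge 3) (Clash 18) (Split 18 (Split 19 (Edge 18) (Split 14 (Edge 9) (Clash 19)
    (Clash 20) (Edge 15)) (Edge 20) (Edge 15)) (Edge 31) (Edge 5) (Edge 15)) (Edge 15))
    (Edge 31) (Edge 4) (Edge 15)) (Edge 8) (Edge 16) (Edge 0)) (Edge 15)) (Edge 7) (Edge 15)))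
    (Edge 4) (Split 22 (Split 15 (Edge 3) (Split 17 (Edge 1) (Edge 15) (Edge 7) (Split 16
    (Edge 1) (Edge 15) (Split 9 (Split 20 (Edge 3) (Edge 15) (Split 19 (Split 32 (Edge 3)
    (Clash 26) (Edge 20) (Split 27 (Edge 19) (Split 26 (Split 33 (Clash 9) (Edge 27) (Split 14
    (Edge 9) (Edge 15) (Edge 33) (Split 18 (Edge 19) (Edge 15) (Edge 5) (Edge 14))) (Edge 17))
    (Edge 27) (Edge 7) (Edge 17)) (Clash 17) (Edge 0))) (Edge 15) (Edge 20) (Split 18 (Split 14
    (Edge 9) (Edge 15) (Clash 20) (Clash 19)) (Edge 15) (Edge 5) (Edge 19))) (Clash 18))
    (Edge 8) (Edge 16) (Edge 0)) (Edge 17))) (Clash 25) (Edge 21)) (Edge 31) (Edge 4)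
    (Edge 21))) (Edge 5) (Edge 0)) (Edge 4) (Edge 0)) (Clash 10)) (Clash 11)) (Edge 0))
    (Edge 0)) (Edge 2) (Clash 0) (Edge 0))"

lemma valid_e:
  "valid [gadget, labels [Eq, Eq]]
    (labels [Eq]) cert_e"
  by code_simp

text \<open>
  If every edge is \<open>Ne\<close>, the colours of one triangle determine, flip by flip, the colours of all points,
  and the coincidences of the graph contradict this forced colouring. Since \<open>Eq\<close> is excluded already, the
  contradiction can be stated as the exclusion of the word \<open>Ne\<close>.
\<close>

definition cert_n :: certificate where
  "cert_n = Certificate
    [(0, 2, 1), (0, 1, 2), (0, 4, 1), (0, 5, 4), (0, 3, 2), (0, 7, 3), (0, 8, 7), (0, 9, 8),
    (6, 5, 0), (6, 11, 5), (9, 10, 0), (9, 13, 10), (9, 14, 13), (12, 11, 6), (15, 14, 9)]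
    [[], [], [], [0, 2], [0, 1], [0, 4], [0, 5], [0, 3], [0, 7], [0, 8], [0, 9], [5, 6, 12],
    [6, 9], [10, 11], [9, 13], [9, 14], [11, 12], [11, 14, 15, 16]]
    [1, 2, 3]
    [(0, 0, [4, 5, 6]), (0, 0, [1, 4, 5]), (0, 0, [2, 1, 4]), (0, 0, [3, 2, 1]),
    (0, 0, [7, 3, 2]), (0, 0, [8, 7, 3]), (0, 0, [9, 8, 7]), (0, 0, [10, 9, 8]),
    (0, 6, [5, 11, 12]), (0, 9, [0, 10, 13]), (0, 9, [10, 13, 14]), (0, 9, [13, 14, 15]),
    (0, 12, [6, 11, 16])]
    (Split 4 (Edge 1) (Clash 3) (Split 5 (Clash 2) (Split 6 (Split 3 (Clash 4) (Edge 2) (Split 7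
    (Split 8 (Edge 7) (Split 9 (Clash 7) (Edge 8) (Split 10 (Split 12 (Edge 6) (Clash 9)
    (Edge 9) (Split 11 (Edge 6) (Edge 5) (Split 13 (Edge 10) (Split 14 (Clash 11) (Edge 13)
    (Edge 9) (Split 15 (Split 16 (Clash 13) (Split 17 (Edge 15) (Edge 16) (Edge 11) (Edge 14))
    (Edge 11) (Edge 12)) (Clash 12) (Edge 9) (Edge 14))) (Edge 11) (Clash 10)) (Edge 12)))
    (Clash 8) (Edge 9) (Edge 0)) (Edge 0)) (Clash 6) (Edge 0)) (Clash 5) (Edge 3) (Edge 0))
    (Edge 0)) (Edge 5) (Clash 1) (Edge 0)) (Edge 4) (Edge 0)) (Edge 0))"

lemma valid_n:
  "valid [labels [Eq]]
    (labels [Ne]) cert_n"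
  by code_simp

context proper_colouring
begin

lemma forbidden_gadget: "forbidden gadget"
  by (rule certificate_sound[OF valid_gadget]) simp

lemma forbidden_eene: "forbidden (labels [Eq, Eq, Ne, Eq])"
  by (rule certificate_sound[OF valid_eene]) (use forbidden_gadget in auto)

lemma forbidden_eenne: "forbidden (labels [Eq, Eq, Ne, Ne, Eq])"
  by (rule certificate_sound[OF valid_eenne]) (use forbidden_gadget forbidden_eene in auto)

lemma forbidden_eeee: "forbidden (labels [Eq, Eq, Eq, Eq])"
  by (rule certificate_sound[OF valid_eeee]) (use forbidden_gadget forbidden_eene in auto)

lemma forbidden_eennnnn: "forbidden (labels [Eq, Eq, Ne, Ne, Ne, Ne, Ne])"
  by (rule certificate_sound[OF valid_eennnnn])
    (use forbidden_gadget forbidden_eene forbidden_eenne forbidden_eeee in auto)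

lemma forbidden_eennnn: "forbidden (labels [Eq, Eq, Ne, Ne, Ne, Ne])"
  by (rule certificate_sound[OF valid_eennnn])
    (use forbidden_gadget forbidden_eene forbidden_eenne forbidden_eeee forbidden_eennnnn in auto)

lemma forbidden_eee: "forbidden (labels [Eq, Eq, Eq])"
  by (rule certificate_sound[OF valid_eee])
    (use forbidden_gadget forbidden_eene forbidden_eenne forbidden_eeee forbidden_eennnn in auto)

lemma forbidden_ee: "forbidden (labels [Eq, Eq])"
  by (rule certificate_sound[OF valid_ee])
    (use forbidden_gadget forbidden_eene forbidden_eenne forbidden_eee forbidden_eennnn in auto)

lemma forbidden_e: "forbidden (labels [Eq])"
  by (rule certificate_sound[OF valid_e]) (use forbidden_gadget forbidden_ee in auto)

lemma forbidden_n: "forbidden (labels [Ne])"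
  by (rule certificate_sound[OF valid_n]) (use forbidden_e in auto)

lemma no_triangle: "\<not> triangle P Q R"
proof
  assume "triangle P Q R"
  then have "\<not> satisfies (\<lambda>i. f (fan u P Q R i)) (labels [Eq])"
    and "\<not> satisfies (\<lambda>i. f (fan u P Q R i)) (labels [Ne])"
    using forbidden_e forbidden_n unfolding forbidden_def by blast+
  then show False by simp
qed

end

section \<open>From the disk to the hyperboloid\<close>

lemma equilateral_triangle_exists:
  assumes "1 < C"
  obtains P Q R where "mink P P = 1" "mink Q Q = 1" "mink R R = 1"
    "mink P Q = C" "mink P R = C" "mink Q R = C"
proof -
  define s where "s = sqrt (C\<^sup>2 - 1)"
  have s2: "s\<^sup>2 = C\<^sup>2 - 1" and s: "s \<noteq> 0"
    using assms by (simp_all add: s_def power2_eq_1_iff)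
  define x where "x = (C\<^sup>2 - C) / s"
  have xs: "s * x = C\<^sup>2 - C"
    using s by (simp add: x_def)
  have "(C\<^sup>2 - C)\<^sup>2 \<le> (C\<^sup>2 - 1)\<^sup>2"
    using assms by (intro power_mono) (simp_all add: power2_eq_square)
  then have "(s * x)\<^sup>2 \<le> s\<^sup>2 * s\<^sup>2"
    unfolding xs s2 by (simp only: power2_eq_square)
  then have "x\<^sup>2 \<le> s\<^sup>2"
    using s by (simp only: power_mult_distrib mult_le_cancel_left zero_less_power2) simp
  define y where "y = sqrt (s\<^sup>2 - x\<^sup>2)"
  have y2: "y\<^sup>2 = s\<^sup>2 - x\<^sup>2"
    using \<open>x\<^sup>2 \<le> s\<^sup>2\<close> by (simp add: y_def)
  show thesis
    by (rule that[of "(1, 0, 0)" "(C, s, 0)" "(C, x, y)"])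
      (use s2 y2 xs in \<open>simp_all add: power2_eq_square algebra_simps\<close>)
qed

text \<open>
  The given value \<open>C\<close> is the positive root of \<open>(4 - \<surd>5) C\<^sup>2 - (1 + \<surd>5) C - 1\<close>, which in terms of
  \<open>u = 2 C / (1 + C)\<close> says \<open>u - 1 / u = (\<surd>5 - 1) / 2\<close>; eliminating \<open>\<surd>5\<close> by squaring gives the
  quartic equation of \<open>u\<close> over the integers. A colouring without a monochromatic pair at distance \<open>d\<close>
  pulls back to a proper colouring of the hyperboloid, which rules out the existence of any equilateral
  triangle of side \<open>d\<close>.
\<close>

theorem mainTheorem1:
  fixes d :: real and \<kappa> :: "real \<times> real \<Rightarrow> nat"
  assumes d_def: "d = arcosh ((9 + 5 * sqrt 5 + (4 + sqrt 5) * sqrt (22 - 2 * sqrt 5)) / 22)"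
    and coloring: "\<kappa> \<in> hyp_plane \<rightarrow> {1, 2, 3, 4}"
  shows "\<exists>P\<in>hyp_plane. \<exists>Q\<in>hyp_plane. hyp_dist P Q = d \<and> \<kappa> P = \<kappa> Q"
proof (rule ccontr)
  assume no_pair: "\<not> ?thesis"
  define C where "C = (9 + 5 * sqrt 5 + (4 + sqrt 5) * sqrt (22 - 2 * sqrt 5)) / 22"
  define u where "u = 2 * C / (1 + C)"
  have "sqrt 5 < sqrt 9"
    by (rule real_sqrt_less_mono) simp
  then have s: "sqrt 5 < 3" by simp
  have s2: "2 < sqrt 5"
    by (rule real_less_rsqrt) simp
  have C1: "1 < C"
  proof -
    have "0 \<le> (4 + sqrt 5) * sqrt (22 - 2 * sqrt 5)"
      using s by simp
    then have "22 < 9 + 5 * sqrt 5 + (4 + sqrt 5) * sqrt (22 - 2 * sqrt 5)" if "13 < 5 * sqrt 5"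
      using that by linarith
    moreover have "1 * 4 \<le> (4 + sqrt 5) * sqrt (22 - 2 * sqrt 5)"
    proof (rule mult_mono)
      have "sqrt 16 \<le> sqrt (22 - 2 * sqrt 5)"
        using s by (intro real_sqrt_le_mono) simp
      then show "4 \<le> sqrt (22 - 2 * sqrt 5)" by simp
    qed (use s in simp_all)
    ultimately show ?thesis
      using s2 by (simp add: C_def)
  qed
  have quadratic: "(4 - sqrt 5) * C\<^sup>2 - (1 + sqrt 5) * C - 1 = 0"
  proof -
    have "22 * (y / 22) = y" for y :: real
      by simp
    then have "22 * C = 9 + 5 * sqrt 5 + (4 + sqrt 5) * sqrt (22 - 2 * sqrt 5)"
      unfolding C_def .
    then have "22 * C - (9 + 5 * sqrt 5) = (4 + sqrt 5) * sqrt (22 - 2 * sqrt 5)"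
      by linarith
    then have "(22 * C - (9 + 5 * sqrt 5))\<^sup>2 = (4 + sqrt 5)\<^sup>2 * (22 - 2 * sqrt 5)"
      using s by (simp add: power_mult_distrib)
    moreover have "(22 * C - (9 + 5 * sqrt 5))\<^sup>2 =
        484 * C\<^sup>2 - 44 * ((9 + 5 * sqrt 5) * C) + (9 + 5 * sqrt 5)\<^sup>2"
      by (simp add: power2_eq_square algebra_simps)
    moreover have "(9 + 5 * sqrt 5)\<^sup>2 = 206 + 90 * sqrt 5" "(4 + sqrt 5)\<^sup>2 = 21 + 8 * sqrt 5"
      by (simp_all add: power2_eq_square algebra_simps)
    moreover have "(21 + 8 * sqrt 5) * (22 - 2 * sqrt 5) = 382 + 134 * sqrt 5"
      by (simp add: algebra_simps)
    ultimately have eq: "11 * C\<^sup>2 = (9 + 5 * sqrt 5) * C + (4 + sqrt 5)"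
      by simp
    have "11 * ((4 - sqrt 5) * C\<^sup>2 - (1 + sqrt 5) * C - 1) =
        (4 - sqrt 5) * (11 * C\<^sup>2) - 11 * (1 + sqrt 5) * C - 11"
      by (simp add: algebra_simps)
    also have "\<dots> = 0"
      unfolding eq by (simp add: algebra_simps)
    finally show ?thesis by simp
  qed
  have u2: "2 * u\<^sup>2 - (sqrt 5 - 1) * u - 2 = 0"
  proof -
    have "u * (1 + C) = 2 * C"
      using C1 by (simp add: u_def)
    have "(2 * u\<^sup>2 - (sqrt 5 - 1) * u - 2) * (1 + C)\<^sup>2 =
        2 * (u * (1 + C))\<^sup>2 - (sqrt 5 - 1) * (u * (1 + C)) * (1 + C) - 2 * (1 + C)\<^sup>2"
      by (simp add: power2_eq_square algebra_simps)
    also have "\<dots> = 2 * ((4 - sqrt 5) * C\<^sup>2 - (1 + sqrt 5) * C - 1)"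
      unfolding \<open>u * (1 + C) = 2 * C\<close> by (simp add: power2_eq_square algebra_simps)
    also have "\<dots> = 0 * (1 + C)\<^sup>2"
      unfolding quadratic by simp
    finally show ?thesis
      using C1 by (simp only: mult_cancel_right) simp
  qed
  have "2 * u\<^sup>2 + u - 2 = sqrt 5 * u"
    using u2 by (simp add: left_diff_distrib)
  then have "(2 * u\<^sup>2 + u - 2)\<^sup>2 = 5 * u\<^sup>2"
    by (simp add: power_mult_distrib)
  moreover have "(2 * u\<^sup>2 + u - 2)\<^sup>2 = 4 * (u ^ 4 + u ^ 3 - 3 * u ^ 2 - u + 1) + 5 * u\<^sup>2"
    by (simp add: power2_eq_square power3_eq_cube power4_eq_xxxx algebra_simps)
  ultimately have "4 * (u ^ 4 + u ^ 3 - 3 * u ^ 2 - u + 1) + 5 * u\<^sup>2 = 5 * u\<^sup>2"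
    by (rule trans[OF sym, rotated])
  then have root: "u ^ 4 + u ^ 3 - 3 * u ^ 2 - u + 1 = 0"
    by (simp only: add_cancel_left_left mult_eq_0_iff) simp
  have uC: "(2 - u) * C = u" and "u \<noteq> 2"
    using C1 by (simp_all add: u_def field_simps)
  interpret proper_colouring u C "\<kappa> \<circ> disc_point"
  proof
    show "(\<kappa> \<circ> disc_point) v \<in> {1, 2, 3, 4}" if "mink v v = 1" for v
      using coloring disc_point_in_hyp_plane[OF that] by auto
    show "(\<kappa> \<circ> disc_point) v \<noteq> (\<kappa> \<circ> disc_point) w"
      if "mink v v = 1" "mink w w = 1" "mink v w = C" for v w
    proof -
      have "hyp_dist (disc_point v) (disc_point w) = d"
        using hyp_dist_disc_point[OF that(1,2)] that(3) C1 unfolding d_def C_def[symmetric] by simp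
      then show ?thesis
        using no_pair disc_point_in_hyp_plane[OF that(1)] disc_point_in_hyp_plane[OF that(2)]
        unfolding comp_def by blast
    qed
  qed (use root uC \<open>u \<noteq> 2\<close> in auto)
  obtain P Q R where "mink P P = 1" "mink Q Q = 1" "mink R R = 1"
      "mink P Q = C" "mink P R = C" "mink Q R = C"
    using equilateral_triangle_exists[OF C1] by blast
  then have "triangle P Q R"
    by (simp add: triangle_def)
  then show False
    using no_triangle by blast
qed

end
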